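(* Let $A = \sigma(R)\langle x_1, \dots, x_n\rangle$ be a skew PBW extension over a $(\Sigma,\Delta)$-compatible and NI ring $R$. If for each subset $X\subseteq R$ with $X\nsubseteq N(R)$, $N_R(X)$ is generated as an ideal by a nilpotent element, then for each subset $U\subseteq A$ with $U\nsubseteq N(A)$, $N_A(U)$ is generated as an ideal by a nilpotent element.
   Context: All rings are associative with identity, not necessarily commutative. $\mathbb{N}$ includes $0$. For a ring $R$, $N(R)$ is the set of nilpotent elements of $R$ and $N^*(R)$ is the sum of all nil ideals of $R$; $R$ is NI if $N^*(R)=N(R)$. Skew PBW extension: $A=\sigma(R)\langle x_1,\dots,x_n\rangle$ is a skew PBW extension over $R$ if (i) $R$ is a subring of $A$ with the same identity; (ii) there are $x_1,\dots,x_n\in A$ such that $A$ is a free left $R$-module with basis $\mathrm{Mon}(A)=\{x^\alpha = x_1^{\alpha_1}\cdots x_n^{\alpha_n} \mid \alpha\in\mathbb{N}^n\}$; (iii) for each $1\le i\le n$ and $r\in R\setminus\{0\}$ there is $c_{i,r}\in R\setminus\{0\}$ with $x_i r - c_{i,r}x_i\in R$; (iv) for all $1\le i,j\le n$ there is $d_{i,j}\in R\setminus\{0\}$ with $x_jx_i - d_{i,j}x_ix_j\in R+Rx_1+\cdots+Rx_n$. For such $A$ there exist, for each $i$, an injective endomorphism $\sigma_i$ of $R$ and a $\sigma_i$-derivation $\delta_i$ of $R$ (additive, $\delta_i(rs)=\sigma_i(r)\delta_i(s)+\delta_i(r)s$) with $x_ir=\sigma_i(r)x_i+\delta_i(r)$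 for all $r\in R$. Put $\Sigma=\{\sigma_1,\dots,\sigma_n\}$, $\Delta=\{\delta_1,\dots,\delta_n\}$, and for $\alpha\in\mathbb{N}^n$, $\sigma^\alpha=\sigma_1^{\alpha_1}\circ\cdots\circ\sigma_n^{\alpha_n}$, $\delta^\alpha=\delta_1^{\alpha_1}\circ\cdots\circ\delta_n^{\alpha_n}$. $R$ is $\Sigma$-compatible if for all $a,b\in R$ and $\alpha\in\mathbb{N}^n$: $a\sigma^\alpha(b)=0$ if and only if $ab=0$. $R$ is $\Delta$-compatible if for all $a,b\in R$ and $\beta\in\mathbb{N}^n$: $ab=0$ implies $a\delta^\beta(b)=0$. $R$ is $(\Sigma,\Delta)$-compatible if it is both. Weak annihilator: for a ring $S$ and $X\subseteq S$, $N_S(X)=\{a\in S\mid xa\in N(S)\text{ for all }x\in X\}$; it is an ideal of $S$ whenever $N(S)$ is. "$N_S(X)$ is generated as an ideal by a nilpotent element" is used in the form: there is $c\in N(S)$ with $N_S(X)=cS$. *)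

theory Defs
  imports "HOL-Algebra.Ideal" "HOL-Algebra.Subrings"
begin

section \<open>Nilpotent elements, NI rings, weak annihilators\<close>

definition nilpotents :: "('a, 'm) ring_scheme \<Rightarrow> 'a set"
  where "nilpotents S = {a \<in> carrier S. \<exists>k::nat. a [^]\<^bsub>S\<^esub> k = \<zero>\<^bsub>S\<^esub>}"

definition nil_ideal :: "'a set \<Rightarrow> ('a, 'm) ring_scheme \<Rightarrow> bool"
  where "nil_ideal I S \<longleftrightarrow> ideal I S \<and> I \<subseteq> nilpotents S"

text \<open>The sum of a family of ideals consists of the finite sums of elements of its members.\<close>

definition upper_nilradical :: "('a, 'm) ring_scheme \<Rightarrow> 'a set"
  where "upper_nilradical S =
    {(\<Oplus>\<^bsub>S\<^esub>I\<in>F. f I) | F f. finite F \<and> (\<forall>I\<in>F. nil_ideal I S \<and> f I \<in> I)}"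

definition NI_ring :: "('a, 'm) ring_scheme \<Rightarrow> bool"
  where "NI_ring S \<longleftrightarrow> ring S \<and> upper_nilradical S = nilpotents S"

definition weak_annihilator :: "('a, 'm) ring_scheme \<Rightarrow> 'a set \<Rightarrow> 'a set"
  where "weak_annihilator S Y = {a \<in> carrier S. \<forall>x\<in>Y. x \<otimes>\<^bsub>S\<^esub> a \<in> nilpotents S}"

text \<open>
  Generation as an ideal by a nilpotent element is used in the form \<open>I = cS\<close>
  with \<open>c\<close> nilpotent.
\<close>

definition generated_by_nilpotent :: "('a, 'm) ring_scheme \<Rightarrow> 'a set \<Rightarrow> bool"
  where "generated_by_nilpotent S I \<longleftrightarrow>
    (\<exists>c\<in>nilpotents S. I = {c \<otimes>\<^bsub>S\<^esub> s | s. s \<in> carrier S})"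


section \<open>Skew PBW extensions\<close>

text \<open>
  The variables are indexed by \<open>0, \<dots>, n - 1\<close>, and a multi-index of length \<open>n\<close> is a function
  \<open>nat \<Rightarrow> nat\<close> that vanishes from \<open>n\<close> on.
\<close>

definition multi_indices :: "nat \<Rightarrow> (nat \<Rightarrow> nat) set"
  where "multi_indices n = {\<alpha>. \<forall>i\<ge>n. \<alpha> i = 0}"

definition monomial ::
    "('a, 'm) ring_scheme \<Rightarrow> nat \<Rightarrow> (nat \<Rightarrow> 'a) \<Rightarrow> (nat \<Rightarrow> nat) \<Rightarrow> 'a"
  where "monomial A n x \<alpha> =
    foldr (\<lambda>i m. (x i [^]\<^bsub>A\<^esub> \<alpha> i) \<otimes>\<^bsub>A\<^esub> m) [0..<n] \<one>\<^bsub>A\<^esub>"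

text \<open>
  The basis condition refers to the family of monomials indexed by multi-indices: distinct
  multi-indices give linearly independent, in particular (for a nonzero ring) distinct, monomials.
\<close>

locale skew_PBW_extension = ring A for A (structure) +
  fixes R :: "'a set" and n :: nat and x :: "nat \<Rightarrow> 'a"
  assumes coeff_subring: "subring R A"
    and var_closed: "\<And>i. i < n \<Longrightarrow> x i \<in> carrier A"
    and spanning: "\<And>a. a \<in> carrier A \<Longrightarrow>
      \<exists>F r. finite F \<and> F \<subseteq> multi_indices n \<and> (\<forall>\<alpha>\<in>F. r \<alpha> \<in> R) \<and>
        a = (\<Oplus>\<alpha>\<in>F. r \<alpha> \<otimes> monomial A n x \<alpha>)"
    and independent: "\<And>F r. finite F \<Longrightarrow> F \<subseteq> multi_indices n \<Longrightarrow> (\<forall>\<alpha>\<in>F. r \<alpha> \<in> R) \<Longrightarrow>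
      (\<Oplus>\<alpha>\<in>F. r \<alpha> \<otimes> monomial A n x \<alpha>) = \<zero> \<Longrightarrow> (\<forall>\<alpha>\<in>F. r \<alpha> = \<zero>)"
    and var_coeff: "\<And>i r. i < n \<Longrightarrow> r \<in> R - {\<zero>} \<Longrightarrow>
      \<exists>c\<in>R - {\<zero>}. x i \<otimes> r \<ominus> c \<otimes> x i \<in> R"
    and var_var: "\<And>i j. i < n \<Longrightarrow> j < n \<Longrightarrow>
      \<exists>d\<in>R - {\<zero>}. x j \<otimes> x i \<ominus> d \<otimes> x i \<otimes> x j \<in>
        {r \<oplus> (\<Oplus>k\<in>{..<n}. s k \<otimes> x k) | r s. r \<in> R \<and> (\<forall>k<n. s k \<in> R)}"

definition is_derivation ::
    "('a, 'm) ring_scheme \<Rightarrow> ('a \<Rightarrow> 'a) \<Rightarrow> ('a \<Rightarrow> 'a) \<Rightarrow> bool"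
  where "is_derivation S \<sigma> \<delta> \<longleftrightarrow> \<delta> \<in> carrier S \<rightarrow> carrier S \<and>
    (\<forall>r\<in>carrier S. \<forall>s\<in>carrier S. \<delta> (r \<oplus>\<^bsub>S\<^esub> s) = \<delta> r \<oplus>\<^bsub>S\<^esub> \<delta> s \<and>
      \<delta> (r \<otimes>\<^bsub>S\<^esub> s) = (\<sigma> r \<otimes>\<^bsub>S\<^esub> \<delta> s) \<oplus>\<^bsub>S\<^esub> (\<delta> r \<otimes>\<^bsub>S\<^esub> s))"

text \<open>
  The families \<open>\<sigma>\<close>, \<open>\<delta>\<close> belonging to a skew PBW extension. Lemmas \<open>structure_maps_exist\<close> and
  \<open>structure_maps_unique\<close> below show that they always exist and are determined on the
  coefficient ring.
\<close>

definition structure_maps ::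
    "('a, 'm) ring_scheme \<Rightarrow> 'a set \<Rightarrow> nat \<Rightarrow> (nat \<Rightarrow> 'a) \<Rightarrow>
      (nat \<Rightarrow> 'a \<Rightarrow> 'a) \<Rightarrow> (nat \<Rightarrow> 'a \<Rightarrow> 'a) \<Rightarrow> bool"
  where "structure_maps A R n x \<sigma> \<delta> \<longleftrightarrow>
    (\<forall>i<n. \<sigma> i \<in> ring_hom (A\<lparr>carrier := R\<rparr>) (A\<lparr>carrier := R\<rparr>) \<and> inj_on (\<sigma> i) R \<and>
      is_derivation (A\<lparr>carrier := R\<rparr>) (\<sigma> i) (\<delta> i) \<and>
      (\<forall>r\<in>R. x i \<otimes>\<^bsub>A\<^esub> r = (\<sigma> i r \<otimes>\<^bsub>A\<^esub> x i) \<oplus>\<^bsub>A\<^esub> \<delta> i r))"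

definition map_power :: "nat \<Rightarrow> (nat \<Rightarrow> 'a \<Rightarrow> 'a) \<Rightarrow> (nat \<Rightarrow> nat) \<Rightarrow> 'a \<Rightarrow> 'a"
  where "map_power n \<phi> \<alpha> = foldr (\<lambda>i g. (\<phi> i ^^ \<alpha> i) \<circ> g) [0..<n] id"

definition Sigma_compatible ::
    "('a, 'm) ring_scheme \<Rightarrow> nat \<Rightarrow> (nat \<Rightarrow> 'a \<Rightarrow> 'a) \<Rightarrow> bool"
  where "Sigma_compatible S n \<sigma> \<longleftrightarrow>
    (\<forall>a\<in>carrier S. \<forall>b\<in>carrier S. \<forall>\<alpha>\<in>multi_indices n.
      a \<otimes>\<^bsub>S\<^esub> map_power n \<sigma> \<alpha> b = \<zero>\<^bsub>S\<^esub> \<longleftrightarrow> a \<otimes>\<^bsub>S\<^esub> b = \<zero>\<^bsub>S\<^esub>)"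

definition Delta_compatible ::
    "('a, 'm) ring_scheme \<Rightarrow> nat \<Rightarrow> (nat \<Rightarrow> 'a \<Rightarrow> 'a) \<Rightarrow> bool"
  where "Delta_compatible S n \<delta> \<longleftrightarrow>
    (\<forall>a\<in>carrier S. \<forall>b\<in>carrier S. \<forall>\<beta>\<in>multi_indices n.
      a \<otimes>\<^bsub>S\<^esub> b = \<zero>\<^bsub>S\<^esub> \<longrightarrow> a \<otimes>\<^bsub>S\<^esub> map_power n \<delta> \<beta> b = \<zero>\<^bsub>S\<^esub>)"


section \<open>Existence and uniqueness of the structure maps\<close>

lemma (in monoid) foldr_pow_zero:
  "(\<And>i. i \<in> set is \<Longrightarrow> \<alpha> i = (0::nat)) \<Longrightarrow> foldr (\<lambda>i m. (x i [^] \<alpha> i) \<otimes> m) is \<one> = \<one>"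
  by (induction "is") auto

lemma (in monoid) foldr_pow_single:
  "j \<in> set is \<Longrightarrow> distinct is \<Longrightarrow> x j \<in> carrier G \<Longrightarrow>
    foldr (\<lambda>i m. (x i [^] (if i = j then 1 else 0::nat)) \<otimes> m) is \<one> = x j"
proof (induction "is")
  case (Cons k ks)
  show ?case
  proof (cases "k = j")
    case True
    then have "foldr (\<lambda>i m. (x i [^] (if i = j then 1 else 0::nat)) \<otimes> m) ks \<one> = \<one>"
      using Cons.prems by (intro foldr_pow_zero) auto
    with True Cons.prems show ?thesis by simp
  next
    case False
    with Cons show ?thesis by simp
  qed
qed simp

context skew_PBW_extension
begin

lemma R_sub: "r \<in> R \<Longrightarrow> r \<in> carrier A"
  and R_zero: "\<zero> \<in> R" and R_one: "\<one> \<in> R"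
  and R_minus: "r \<in> R \<Longrightarrow> \<ominus> r \<in> R"
  and R_mult: "r \<in> R \<Longrightarrow> s \<in> R \<Longrightarrow> r \<otimes> s \<in> R"
  and R_add: "r \<in> R \<Longrightarrow> s \<in> R \<Longrightarrow> r \<oplus> s \<in> R"
  using subringE[OF coeff_subring] by auto

lemma linear_zero:
  assumes i: "i < n" and a: "a \<in> R" and b: "b \<in> R" and eq: "a \<otimes> x i \<oplus> b = \<zero>"
  shows "a = \<zero>" and "b = \<zero>"
proof -
  define e :: "nat \<Rightarrow> nat" where "e = (\<lambda>k. if k = i then 1 else 0)"
  define z :: "nat \<Rightarrow> nat" where "z = (\<lambda>k. 0)"
  define r where "r = (\<lambda>\<alpha>. if \<alpha> = e then a else b)"
  have ez: "e \<noteq> z" by (auto simp: e_def z_def fun_eq_iff)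
  have me: "monomial A n x e = x i"
    unfolding monomial_def e_def using i var_closed by (intro foldr_pow_single) auto
  have mz: "monomial A n x z = \<one>"
    unfolding monomial_def z_def by (intro foldr_pow_zero) auto
  have xi: "x i \<in> carrier A" using var_closed i .
  have "(\<Oplus>\<alpha>\<in>{e, z}. r \<alpha> \<otimes> monomial A n x \<alpha>)
      = r e \<otimes> monomial A n x e \<oplus> r z \<otimes> monomial A n x z"
    using ez a b xi by (simp add: R_sub me mz r_def)
  also have "\<dots> = a \<otimes> x i \<oplus> b" using ez b by (simp add: r_def me mz R_sub)
  finally have "(\<Oplus>\<alpha>\<in>{e, z}. r \<alpha> \<otimes> monomial A n x \<alpha>) = \<zero>" using eq by simp
  moreover have "{e, z} \<subseteq> multi_indices n" using i by (auto simp: multi_indices_def e_def z_def)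
  moreover have "\<forall>\<alpha>\<in>{e, z}. r \<alpha> \<in> R" using a b by (auto simp: r_def)
  ultimately have "\<forall>\<alpha>\<in>{e, z}. r \<alpha> = \<zero>" by (intro independent) auto
  then show "a = \<zero>" "b = \<zero>" using ez by (auto simp: r_def split: if_splits)
qed

lemma linear_cancel:
  assumes i: "i < n" and R: "a \<in> R" "b \<in> R" "a' \<in> R" "b' \<in> R"
    and eq: "a \<otimes> x i \<oplus> b = a' \<otimes> x i \<oplus> b'"
  shows "a = a'" and "b = b'"
proof -
  have c: "a \<in> carrier A" "b \<in> carrier A" "a' \<in> carrier A" "b' \<in> carrier A" "x i \<in> carrier A"
    using R i by (auto simp: R_sub var_closed)
  have "(a \<ominus> a') \<otimes> x i \<oplus> (b \<ominus> b') = (a \<otimes> x i \<oplus> b) \<ominus> (a' \<otimes> x i \<oplus> b')"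
    using c by algebra
  also have "\<dots> = \<zero>" using eq c by (simp add: r_neg minus_eq)
  finally have *: "(a \<ominus> a') \<otimes> x i \<oplus> (b \<ominus> b') = \<zero>" .
  have "a \<ominus> a' \<in> R" "b \<ominus> b' \<in> R" using R by (auto simp: minus_eq R_add R_minus)
  from linear_zero[OF i this *] have "a \<ominus> a' = \<zero>" "b \<ominus> b' = \<zero>" by auto
  with c show "a = a'" "b = b'" by (simp_all only: r_right_minus_eq)
qed

lemma structure_maps_unique:
  assumes "structure_maps A R n x \<sigma> \<delta>" "structure_maps A R n x \<sigma>' \<delta>'" "i < n" "r \<in> R"
  shows "\<sigma> i r = \<sigma>' i r" and "\<delta> i r = \<delta>' i r"
proof -
  have "\<sigma> i r \<in> R" "\<delta> i r \<in> R" "\<sigma>' i r \<in> R" "\<delta>' i r \<in> R"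
    using assms by (auto simp: structure_maps_def ring_hom_def is_derivation_def)
  moreover have "\<sigma> i r \<otimes> x i \<oplus> \<delta> i r = \<sigma>' i r \<otimes> x i \<oplus> \<delta>' i r"
    using assms unfolding structure_maps_def by metis
  ultimately show "\<sigma> i r = \<sigma>' i r" "\<delta> i r = \<delta>' i r"
    using linear_cancel[OF \<open>i < n\<close>] by auto
qed

lemma structure_mapsI:
  assumes "\<And>i r. i < n \<Longrightarrow> r \<in> R \<Longrightarrow>
    \<sigma> i r \<in> R \<and> \<delta> i r \<in> R \<and> x i \<otimes> r = \<sigma> i r \<otimes> x i \<oplus> \<delta> i r"
  shows "structure_maps A R n x \<sigma> \<delta>"
  unfolding structure_maps_def
proof (intro allI impI)
  fix i assume i: "i < n"
  note xi = var_closed[OF i]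
  have sR: "\<And>r. r \<in> R \<Longrightarrow> \<sigma> i r \<in> R" and dR: "\<And>r. r \<in> R \<Longrightarrow> \<delta> i r \<in> R"
    and eq: "\<And>r. r \<in> R \<Longrightarrow> x i \<otimes> r = \<sigma> i r \<otimes> x i \<oplus> \<delta> i r"
    using assms i by auto
  have add: "\<sigma> i (r \<oplus> s) = \<sigma> i r \<oplus> \<sigma> i s \<and> \<delta> i (r \<oplus> s) = \<delta> i r \<oplus> \<delta> i s"
    if r: "r \<in> R" and s: "s \<in> R" for r s
  proof -
    have c: "r \<in> carrier A" "s \<in> carrier A" "\<sigma> i r \<in> carrier A" "\<sigma> i s \<in> carrier A"
      "\<delta> i r \<in> carrier A" "\<delta> i s \<in> carrier A"
      using r s by (auto intro: R_sub sR dR)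
    have "\<sigma> i (r \<oplus> s) \<otimes> x i \<oplus> \<delta> i (r \<oplus> s) = x i \<otimes> r \<oplus> x i \<otimes> s"
      using eq[OF R_add[OF r s]] c xi by (simp add: r_distr)
    also have "\<dots> = (\<sigma> i r \<oplus> \<sigma> i s) \<otimes> x i \<oplus> (\<delta> i r \<oplus> \<delta> i s)"
      unfolding eq[OF r] eq[OF s] using c xi by algebra
    finally have e: "\<sigma> i (r \<oplus> s) \<otimes> x i \<oplus> \<delta> i (r \<oplus> s)
        = (\<sigma> i r \<oplus> \<sigma> i s) \<otimes> x i \<oplus> (\<delta> i r \<oplus> \<delta> i s)" .
    show ?thesis
      using linear_cancel[OF i _ _ _ _ e] r s by (simp add: R_add sR dR)
  qed
  have mult: "\<sigma> i (r \<otimes> s) = \<sigma> i r \<otimes> \<sigma> i s \<and> \<delta> i (r \<otimes> s) = \<sigma> i r \<otimes> \<delta> i s \<oplus> \<delta> i r \<otimes> s"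
    if r: "r \<in> R" and s: "s \<in> R" for r s
  proof -
    have c: "r \<in> carrier A" "s \<in> carrier A" "\<sigma> i r \<in> carrier A" "\<sigma> i s \<in> carrier A"
      "\<delta> i r \<in> carrier A" "\<delta> i s \<in> carrier A"
      using r s by (auto intro: R_sub sR dR)
    have "\<sigma> i (r \<otimes> s) \<otimes> x i \<oplus> \<delta> i (r \<otimes> s) = (x i \<otimes> r) \<otimes> s"
      using eq[OF R_mult[OF r s]] c xi by (simp add: m_assoc)
    also have "\<dots> = \<sigma> i r \<otimes> (x i \<otimes> s) \<oplus> \<delta> i r \<otimes> s"
      unfolding eq[OF r] using c xi by (simp add: l_distr m_assoc)
    also have "\<dots> = (\<sigma> i r \<otimes> \<sigma> i s) \<otimes> x i \<oplus> (\<sigma> i r \<otimes> \<delta> i s \<oplus> \<delta> i r \<otimes> s)"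
      unfolding eq[OF s] using c xi by (simp add: r_distr m_assoc a_assoc)
    finally have e: "\<sigma> i (r \<otimes> s) \<otimes> x i \<oplus> \<delta> i (r \<otimes> s)
        = (\<sigma> i r \<otimes> \<sigma> i s) \<otimes> x i \<oplus> (\<sigma> i r \<otimes> \<delta> i s \<oplus> \<delta> i r \<otimes> s)" .
    show ?thesis
      using linear_cancel[OF i _ _ _ _ e] r s by (simp add: R_add R_mult sR dR)
  qed
  have one: "\<sigma> i \<one> = \<one>"
  proof -
    have e: "\<sigma> i \<one> \<otimes> x i \<oplus> \<delta> i \<one> = \<one> \<otimes> x i \<oplus> \<zero>"
      using eq[OF R_one] xi by simp
    show ?thesis using linear_cancel(1)[OF i _ _ _ _ e] by (simp add: R_one R_zero sR dR)
  qed
  have nonzero: "\<sigma> i r \<noteq> \<zero>" if r: "r \<in> R" "r \<noteq> \<zero>" for r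
  proof -
    obtain c where c: "c \<in> R" "c \<noteq> \<zero>" and d: "x i \<otimes> r \<ominus> c \<otimes> x i \<in> R"
      using var_coeff[OF i, of r] r by auto
    have cl: "c \<in> carrier A" "r \<in> carrier A" using c r by (auto intro: R_sub)
    have "x i \<otimes> r = c \<otimes> x i \<oplus> (x i \<otimes> r \<ominus> c \<otimes> x i)"
      using cl xi by algebra
    then have "\<sigma> i r \<otimes> x i \<oplus> \<delta> i r = c \<otimes> x i \<oplus> (x i \<otimes> r \<ominus> c \<otimes> x i)"
      using eq[OF r(1)] by simp
    then have "\<sigma> i r = c" using linear_cancel(1)[OF i] sR[OF r(1)] dR[OF r(1)] c d by blast
    with c show ?thesis by simp
  qed
  have inj: "inj_on (\<sigma> i) R"
  proof (rule inj_onI)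
    fix r s assume r: "r \<in> R" and s: "s \<in> R" and e: "\<sigma> i r = \<sigma> i s"
    have m: "r \<ominus> s \<in> R" using r s by (simp add: minus_eq R_add R_minus)
    have c: "r \<in> carrier A" "s \<in> carrier A" using r s by (auto intro: R_sub)
    then have "(r \<ominus> s) \<oplus> s = r" by algebra
    then have "\<sigma> i (r \<ominus> s) \<oplus> \<sigma> i s = \<sigma> i s" using add[OF m s] e by simp
    then have "\<sigma> i (r \<ominus> s) = \<zero>"
      using R_sub[OF sR[OF m]] R_sub[OF sR[OF s]] add.r_cancel_one' by metis
    then have "r \<ominus> s = \<zero>" using nonzero[OF m] by blast
    then show "r = s" using c by (simp only: r_right_minus_eq)
  qed
  show "\<sigma> i \<in> ring_hom (A\<lparr>carrier := R\<rparr>) (A\<lparr>carrier := R\<rparr>) \<and> inj_on (\<sigma> i) R \<and>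
      is_derivation (A\<lparr>carrier := R\<rparr>) (\<sigma> i) (\<delta> i) \<and>
      (\<forall>r\<in>R. x i \<otimes> r = \<sigma> i r \<otimes> x i \<oplus> \<delta> i r)"
    unfolding ring_hom_def is_derivation_def
    using inj by (simp add: Pi_iff sR dR add mult one eq[symmetric])
qed

lemma structure_maps_exist: "\<exists>\<sigma> \<delta>. structure_maps A R n x \<sigma> \<delta>"
proof -
  have "\<exists>c d. c \<in> R \<and> d \<in> R \<and> x i \<otimes> r = c \<otimes> x i \<oplus> d" if i: "i < n" and r: "r \<in> R" for i r
  proof (cases "r = \<zero>")
    case True
    then show ?thesis using var_closed[OF i] R_zero by (intro exI[of _ \<zero>]) simp
  next
    case False
    then obtain c where c: "c \<in> R" and d: "x i \<otimes> r \<ominus> c \<otimes> x i \<in> R"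
      using var_coeff[OF i, of r] r by auto
    have "c \<in> carrier A" "r \<in> carrier A" "x i \<in> carrier A"
      using c r i by (auto intro: R_sub var_closed)
    then have "x i \<otimes> r = c \<otimes> x i \<oplus> (x i \<otimes> r \<ominus> c \<otimes> x i)" by algebra
    with c d show ?thesis by blast
  qed
  then obtain \<sigma> \<delta> where "\<And>i r. i < n \<Longrightarrow> r \<in> R \<Longrightarrow>
      \<sigma> i r \<in> R \<and> \<delta> i r \<in> R \<and> x i \<otimes> r = \<sigma> i r \<otimes> x i \<oplus> \<delta> i r"
    by metis
  then show ?thesis using structure_mapsI by blast
qed

end

end

theory Submission
  imports Defs
begin

text \<open>
  Write \<open>N\<close> for the set of nilpotent elements of \<open>R\<close>. If \<open>A\<close> is nonzero, the hypothesis on weak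
  annihilators applies to \<open>Y = {1}\<close>, whose weak annihilator is \<open>N\<close> itself: so \<open>N = cR\<close> with \<open>c\<close>
  nilpotent, and \<open>N\<close> is an ideal. This is the decisive gain. For a nil ideal that is
  not nilpotent, elements of \<open>A\<close> with nilpotent coefficients may fail to be nilpotent (already for
  ordinary polynomials), but here the elements of \<open>A\<close> with all coefficients in \<open>N\<close> form the ideal
  \<open>cA\<close>, and their \<open>k\<close>-th powers lie in \<open>c\<^sup>k A\<close>; hence they are all nilpotent (\<open>nilpotents_eq_coefs\<close>).

  Conversely, nilpotent elements of \<open>A\<close> have coefficients in \<open>N\<close>. The ring \<open>R/N\<close> is reduced and
  inherits compatibility (\<open>compatible_ideal_nilpotents\<close>): \<open>ab \<in> N\<close> if and only if
  \<open>a \<sigma>\<^sub>i(b) \<in> N\<close>, and then also \<open>a \<delta>\<^sub>i(b) \<in> N\<close>. Over such a coefficient ring, \<open>A\<close> behaves like an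
  Armendariz ring: the coefficients of \<open>uf\<close> lie in \<open>N\<close> if and only if every product of a
  coefficient of \<open>u\<close> with a coefficient of \<open>f\<close> does. The direction from coefficients to products
  (\<open>mult_coefs_in_N\<close>) holds because \<open>{b. ab \<in> N}\<close> is a right ideal stable under all \<open>\<sigma>\<^sub>i\<close> and
  \<open>\<delta>\<^sub>i\<close>. The other one (\<open>coefs_mult_in_N\<close>) compares leading terms: modulo terms of smaller total
  degree, \<open>x\<^sup>\<alpha> b x\<^sup>\<beta>\<close> is \<open>b' x\<^bsup>\<alpha>+\<beta>\<^esup>\<close>, where \<open>b'\<close> has the same left annihilator modulo \<open>N\<close> as \<open>b\<close>
  (\<open>mult_term_leading\<close>).

  With both facts, an element \<open>f\<close> lies in the weak annihilator of \<open>U \<subseteq> A\<close> if and only if all its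
  coefficients lie in the weak annihilator in \<open>R\<close> of the set \<open>Y\<close> of all coefficients of elements of
  \<open>U\<close>. If \<open>U\<close> is not contained in the nilpotent elements of \<open>A\<close>, then \<open>Y\<close> is not contained in \<open>N\<close>,
  so that weak annihilator is \<open>dR\<close> with \<open>d\<close> nilpotent, and the elements of \<open>A\<close> with coefficients in \<open>dR\<close>
  form \<open>dA\<close>.
\<close>

section \<open>Coefficients\<close>

context skew_PBW_extension
begin

abbreviation mon :: "(nat \<Rightarrow> nat) \<Rightarrow> 'a"
  where "mon \<equiv> monomial A n x"

abbreviation MI :: "(nat \<Rightarrow> nat) set"
  where "MI \<equiv> multi_indices n"

definition coef :: "'a \<Rightarrow> (nat \<Rightarrow> nat) \<Rightarrow> 'a"
  where "coef a = (SOME r. finite {\<alpha>. r \<alpha> \<noteq> \<zero>} \<and> {\<alpha>. r \<alpha> \<noteq> \<zero>} \<subseteq> MI \<and> range r \<subseteq> R \<and>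
    a = (\<Oplus>\<alpha>\<in>{\<alpha>. r \<alpha> \<noteq> \<zero>}. r \<alpha> \<otimes> mon \<alpha>))"

lemma mon_closed [simp]: "mon \<alpha> \<in> carrier A"
proof -
  have "set is \<subseteq> {..<n} \<Longrightarrow> foldr (\<lambda>i m. (x i [^] \<alpha> i) \<otimes> m) is \<one> \<in> carrier A" for "is"
    by (induction "is") (auto simp: var_closed)
  then show ?thesis unfolding monomial_def by (simp add: atLeast0LessThan)
qed

lemma finsum_support:
  assumes "finite F" "\<And>\<alpha>. r \<alpha> \<in> R" "\<And>\<alpha>. \<alpha> \<notin> F \<Longrightarrow> r \<alpha> = \<zero>"
  shows "(\<Oplus>\<alpha>\<in>{\<alpha>. r \<alpha> \<noteq> \<zero>}. r \<alpha> \<otimes> mon \<alpha>) = (\<Oplus>\<alpha>\<in>F. r \<alpha> \<otimes> mon \<alpha>)"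
  using assms by (intro add.finprod_mono_neutral_cong_left) (auto simp: R_sub)

lemma finsum_unique:
  assumes F: "finite F" "F \<subseteq> MI" and r: "\<And>\<alpha>. r \<alpha> \<in> R" and s: "\<And>\<alpha>. s \<alpha> \<in> R"
    and eq: "(\<Oplus>\<alpha>\<in>F. r \<alpha> \<otimes> mon \<alpha>) = (\<Oplus>\<alpha>\<in>F. s \<alpha> \<otimes> mon \<alpha>)" and \<alpha>: "\<alpha> \<in> F"
  shows "r \<alpha> = s \<alpha>"
proof -
  note c = R_sub[OF r] R_sub[OF s]
  have "(\<Oplus>\<alpha>\<in>F. r \<alpha> \<otimes> mon \<alpha>) = (\<Oplus>\<alpha>\<in>F. ((r \<alpha> \<ominus> s \<alpha>) \<otimes> mon \<alpha>) \<oplus> (s \<alpha> \<otimes> mon \<alpha>))"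
    using c
    by (intro add.finprod_cong' refl)
      (auto simp: minus_eq l_distr a_assoc l_minus l_neg)
  also have "\<dots> = (\<Oplus>\<alpha>\<in>F. (r \<alpha> \<ominus> s \<alpha>) \<otimes> mon \<alpha>) \<oplus> (\<Oplus>\<alpha>\<in>F. s \<alpha> \<otimes> mon \<alpha>)"
    using c by (intro finsum_addf) auto
  finally have "(\<Oplus>\<alpha>\<in>F. (r \<alpha> \<ominus> s \<alpha>) \<otimes> mon \<alpha>) \<oplus> (\<Oplus>\<alpha>\<in>F. s \<alpha> \<otimes> mon \<alpha>) = (\<Oplus>\<alpha>\<in>F. s \<alpha> \<otimes> mon \<alpha>)"
    using eq by simp
  moreover have "(\<Oplus>\<alpha>\<in>F. (r \<alpha> \<ominus> s \<alpha>) \<otimes> mon \<alpha>) \<in> carrier A"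
    "(\<Oplus>\<alpha>\<in>F. s \<alpha> \<otimes> mon \<alpha>) \<in> carrier A"
    using c by (auto intro!: finsum_closed)
  ultimately have "(\<Oplus>\<alpha>\<in>F. (r \<alpha> \<ominus> s \<alpha>) \<otimes> mon \<alpha>) = \<zero>"
    by (simp only: add.r_cancel_one)
  then have "r \<alpha> \<ominus> s \<alpha> = \<zero>"
    using independent[OF F, of "\<lambda>\<alpha>. r \<alpha> \<ominus> s \<alpha>"] \<alpha> r s
    by (auto simp: minus_eq R_add R_minus)
  then show ?thesis using c by simp
qed

lemma
  assumes a: "a \<in> carrier A"
  shows coef_finite: "finite {\<alpha>. coef a \<alpha> \<noteq> \<zero>}"
    and coef_support: "coef a \<alpha> \<noteq> \<zero> \<Longrightarrow> \<alpha> \<in> MI"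
    and coef_closed: "coef a \<alpha> \<in> R"
    and coef_expand: "(\<Oplus>\<alpha>\<in>{\<alpha>. coef a \<alpha> \<noteq> \<zero>}. coef a \<alpha> \<otimes> mon \<alpha>) = a"
proof -
  obtain F r where F: "finite F" "F \<subseteq> MI" and r: "\<forall>\<alpha>\<in>F. r \<alpha> \<in> R"
    and eq: "a = (\<Oplus>\<alpha>\<in>F. r \<alpha> \<otimes> mon \<alpha>)"
    using spanning[OF a] by blast
  define s where "s = (\<lambda>\<alpha>. if \<alpha> \<in> F then r \<alpha> else \<zero>)"
  have s: "\<And>\<alpha>. s \<alpha> \<in> R" using r by (auto simp: s_def R_zero)
  have supp: "{\<alpha>. s \<alpha> \<noteq> \<zero>} \<subseteq> F" by (auto simp: s_def)
  have "a = (\<Oplus>\<alpha>\<in>F. s \<alpha> \<otimes> mon \<alpha>)"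
    unfolding eq using r by (intro add.finprod_cong' refl) (auto simp: s_def R_sub)
  also have "\<dots> = (\<Oplus>\<alpha>\<in>{\<alpha>. s \<alpha> \<noteq> \<zero>}. s \<alpha> \<otimes> mon \<alpha>)"
    using F s by (intro finsum_support[symmetric]) (auto simp: s_def)
  finally have "\<exists>r. finite {\<alpha>. r \<alpha> \<noteq> \<zero>} \<and> {\<alpha>. r \<alpha> \<noteq> \<zero>} \<subseteq> MI \<and> range r \<subseteq> R \<and>
      a = (\<Oplus>\<alpha>\<in>{\<alpha>. r \<alpha> \<noteq> \<zero>}. r \<alpha> \<otimes> mon \<alpha>)"
    using F supp s by (intro exI[of _ s]) (auto intro: finite_subset)
  from someI_ex[OF this, folded coef_def]
  show "finite {\<alpha>. coef a \<alpha> \<noteq> \<zero>}" "coef a \<alpha> \<noteq> \<zero> \<Longrightarrow> \<alpha> \<in> MI" "coef a \<alpha> \<in> R"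
    "(\<Oplus>\<alpha>\<in>{\<alpha>. coef a \<alpha> \<noteq> \<zero>}. coef a \<alpha> \<otimes> mon \<alpha>) = a" by auto
qed

lemma coef_carrier [simp]: "a \<in> carrier A \<Longrightarrow> coef a \<alpha> \<in> carrier A"
  by (simp add: R_sub coef_closed)

lemma coef_expand_superset:
  assumes "a \<in> carrier A" "finite F" "{\<alpha>. coef a \<alpha> \<noteq> \<zero>} \<subseteq> F"
  shows "(\<Oplus>\<alpha>\<in>F. coef a \<alpha> \<otimes> mon \<alpha>) = a"
proof -
  have "(\<Oplus>\<alpha>\<in>{\<alpha>. coef a \<alpha> \<noteq> \<zero>}. coef a \<alpha> \<otimes> mon \<alpha>) = (\<Oplus>\<alpha>\<in>F. coef a \<alpha> \<otimes> mon \<alpha>)"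
    using assms by (intro finsum_support coef_closed) auto
  then show ?thesis using coef_expand[OF assms(1)] by simp
qed

lemma coefI:
  assumes F: "finite F" "F \<subseteq> MI" and r: "\<And>\<alpha>. r \<alpha> \<in> R" and z: "\<And>\<alpha>. \<alpha> \<notin> F \<Longrightarrow> r \<alpha> = \<zero>"
  shows "coef (\<Oplus>\<alpha>\<in>F. r \<alpha> \<otimes> mon \<alpha>) = r"
proof
  fix \<alpha>
  define a where "a = (\<Oplus>\<alpha>\<in>F. r \<alpha> \<otimes> mon \<alpha>)"
  have a: "a \<in> carrier A" unfolding a_def using r by (auto intro!: finsum_closed simp: R_sub)
  define G where "G = F \<union> {\<alpha>. coef a \<alpha> \<noteq> \<zero>}"
  have G: "finite G" "G \<subseteq> MI" using F coef_finite[OF a] coef_support[OF a] by (auto simp: G_def)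
  have "(\<Oplus>\<alpha>\<in>G. r \<alpha> \<otimes> mon \<alpha>) = a"
  proof -
    have "(\<Oplus>\<alpha>\<in>{\<alpha>. r \<alpha> \<noteq> \<zero>}. r \<alpha> \<otimes> mon \<alpha>) = (\<Oplus>\<alpha>\<in>G. r \<alpha> \<otimes> mon \<alpha>)"
      using G r z by (intro finsum_support) (auto simp: G_def)
    moreover have "(\<Oplus>\<alpha>\<in>{\<alpha>. r \<alpha> \<noteq> \<zero>}. r \<alpha> \<otimes> mon \<alpha>) = a"
      unfolding a_def using F r z by (intro finsum_support) auto
    ultimately show ?thesis by simp
  qed
  moreover have "(\<Oplus>\<alpha>\<in>G. coef a \<alpha> \<otimes> mon \<alpha>) = a"
    by (rule coef_expand_superset[OF a G(1)]) (simp add: G_def)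
  ultimately have eq: "(\<Oplus>\<alpha>\<in>G. coef a \<alpha> \<otimes> mon \<alpha>) = (\<Oplus>\<alpha>\<in>G. r \<alpha> \<otimes> mon \<alpha>)" by simp
  have "coef a \<alpha> = r \<alpha>" if "\<alpha> \<in> G"
    by (rule finsum_unique[of G "coef a" r, OF G coef_closed[OF a] r eq that])
  moreover have "coef a \<alpha> = r \<alpha>" if "\<alpha> \<notin> G"
    using z[of \<alpha>] that by (simp add: G_def)
  ultimately show "coef (\<Oplus>\<alpha>\<in>F. r \<alpha> \<otimes> mon \<alpha>) \<alpha> = r \<alpha>"
    unfolding a_def[symmetric] by blast
qed

lemma coef_add [simp]:
  assumes a: "a \<in> carrier A" and b: "b \<in> carrier A"
  shows "coef (a \<oplus> b) \<alpha> = coef a \<alpha> \<oplus> coef b \<alpha>"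
proof -
  define F where "F = {\<alpha>. coef a \<alpha> \<noteq> \<zero>} \<union> {\<alpha>. coef b \<alpha> \<noteq> \<zero>}"
  have F: "finite F" "F \<subseteq> MI"
    using coef_finite coef_support a b by (auto simp: F_def)
  have "(\<Oplus>\<alpha>\<in>F. (coef a \<alpha> \<oplus> coef b \<alpha>) \<otimes> mon \<alpha>)
      = (\<Oplus>\<alpha>\<in>F. coef a \<alpha> \<otimes> mon \<alpha> \<oplus> coef b \<alpha> \<otimes> mon \<alpha>)"
    using a b by (intro add.finprod_cong' refl) (auto simp: l_distr)
  also have "\<dots> = a \<oplus> b"
    using a b F coef_expand_superset[of a F] coef_expand_superset[of b F]
    by (subst finsum_addf) (auto simp: F_def)
  finally show ?thesis
    using coefI[OF F, of "\<lambda>\<alpha>. coef a \<alpha> \<oplus> coef b \<alpha>"] a b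
    by (auto simp: coef_closed R_add F_def)
qed

lemma coef_smult [simp]:
  assumes r: "r \<in> R" and a: "a \<in> carrier A"
  shows "coef (r \<otimes> a) \<alpha> = r \<otimes> coef a \<alpha>"
proof -
  define F where "F = {\<alpha>. coef a \<alpha> \<noteq> \<zero>}"
  have F: "finite F" "F \<subseteq> MI" using coef_finite coef_support a by (auto simp: F_def)
  have "(\<Oplus>\<alpha>\<in>F. (r \<otimes> coef a \<alpha>) \<otimes> mon \<alpha>) = (\<Oplus>\<alpha>\<in>F. r \<otimes> (coef a \<alpha> \<otimes> mon \<alpha>))"
    using a r by (intro add.finprod_cong' refl) (auto simp: m_assoc R_sub)
  also have "\<dots> = r \<otimes> a"
    using a r F coef_expand_superset[of a F]
    by (subst finsum_rdistr[symmetric]) (auto simp: F_def R_sub)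
  finally show ?thesis
    using coefI[OF F, of "\<lambda>\<alpha>. r \<otimes> coef a \<alpha>"] a r
    by (auto simp: coef_closed R_mult F_def R_sub)
qed

lemma coef_zero [simp]: "coef \<zero> \<alpha> = \<zero>"
  using coefI[of "{}" "\<lambda>_. \<zero>"] by (simp add: R_zero)

lemma coef_minus [simp]: "a \<in> carrier A \<Longrightarrow> coef (\<ominus> a) \<alpha> = \<ominus> coef a \<alpha>"
  using coef_smult[of "\<ominus> \<one>" a \<alpha>] by (simp add: R_minus R_one l_minus)

lemma coef_term [simp]:
  assumes r: "r \<in> R" and \<gamma>: "\<gamma> \<in> MI"
  shows "coef (r \<otimes> mon \<gamma>) \<alpha> = (if \<alpha> = \<gamma> then r else \<zero>)"
  using coefI[of "{\<gamma>}" "\<lambda>\<alpha>. if \<alpha> = \<gamma> then r else \<zero>"] assms by (simp add: R_zero R_sub)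

lemma coef_mon [simp]: "\<gamma> \<in> MI \<Longrightarrow> coef (mon \<gamma>) \<alpha> = (if \<alpha> = \<gamma> then \<one> else \<zero>)"
  using coef_term[of \<one> \<gamma> \<alpha>] by (simp add: R_one)

lemma finsum_induct:
  assumes "finite F" "\<And>i. i \<in> F \<Longrightarrow> g i \<in> carrier A" "P \<zero>"
    and "\<And>p q. p \<in> carrier A \<Longrightarrow> q \<in> carrier A \<Longrightarrow> P p \<Longrightarrow> P q \<Longrightarrow> P (p \<oplus> q)"
    and "\<And>i. i \<in> F \<Longrightarrow> P (g i)"
  shows "P (\<Oplus>i\<in>F. g i)"
  using assms(1,2,5)
proof (induction F)
  case (insert i F)
  then have "(\<Oplus>i\<in>insert i F. g i) = g i \<oplus> (\<Oplus>i\<in>F. g i)" by (intro finsum_insert) auto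
  moreover have "(\<Oplus>i\<in>F. g i) \<in> carrier A" using insert by (intro finsum_closed) auto
  ultimately show ?case using insert assms(4)[of "g i" "\<Oplus>i\<in>F. g i"] by simp
qed (simp add: assms(3))

text \<open>
  Every additively closed property of the terms of an element holds for the element. The terms carry
  the coefficients of that element, so restrictions on its support or on its coefficients are
  available in the induction step.
\<close>

lemma term_induct:
  assumes a: "a \<in> carrier A" and "P \<zero>"
    and "\<And>p q. p \<in> carrier A \<Longrightarrow> q \<in> carrier A \<Longrightarrow> P p \<Longrightarrow> P q \<Longrightarrow> P (p \<oplus> q)"
    and "\<And>\<alpha>. \<alpha> \<in> MI \<Longrightarrow> coef a \<alpha> \<noteq> \<zero> \<Longrightarrow> P (coef a \<alpha> \<otimes> mon \<alpha>)"
  shows "P a"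
proof -
  have "P (\<Oplus>\<alpha>\<in>{\<alpha>. coef a \<alpha> \<noteq> \<zero>}. coef a \<alpha> \<otimes> mon \<alpha>)"
    by (rule finsum_induct[where P = P]) (use assms coef_finite coef_support in auto)
  then show ?thesis using coef_expand[OF a] by simp
qed

end

section \<open>Products of monomials\<close>

definition bump :: "nat \<Rightarrow> (nat \<Rightarrow> nat) \<Rightarrow> nat \<Rightarrow> nat"
  where "bump i \<alpha> = \<alpha>(i := Suc (\<alpha> i))"

context skew_PBW_extension
begin

definition deg :: "(nat \<Rightarrow> nat) \<Rightarrow> nat"
  where "deg \<alpha> = (\<Sum>i<n. \<alpha> i)"

lemma zero_MI [simp]: "(\<lambda>_. 0) \<in> MI"
  by (simp add: multi_indices_def)

lemma bump_MI [simp]: "i < n \<Longrightarrow> \<alpha> \<in> MI \<Longrightarrow> bump i \<alpha> \<in> MI"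
  by (auto simp: multi_indices_def bump_def)

lemma add_MI [simp]: "\<alpha> \<in> MI \<Longrightarrow> \<beta> \<in> MI \<Longrightarrow> (\<lambda>k. \<alpha> k + \<beta> k) \<in> MI"
  by (auto simp: multi_indices_def)

lemma bump_add: "(\<lambda>k. bump i \<alpha> k + \<beta> k) = bump i (\<lambda>k. \<alpha> k + \<beta> k)"
  by (auto simp: bump_def)

lemma deg_zero [simp]: "deg (\<lambda>_. 0) = 0"
  by (simp add: deg_def)

lemma deg_bump [simp]: "i < n \<Longrightarrow> deg (bump i \<alpha>) = Suc (deg \<alpha>)"
proof -
  assume i: "i < n"
  have "(\<Sum>k<n. bump i \<alpha> k) = (\<Sum>k<n. \<alpha> k + (if k = i then 1 else 0))"
    by (intro sum.cong) (auto simp: bump_def)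
  with i show ?thesis by (simp add: deg_def sum.distrib)
qed

lemma deg_add: "deg (\<lambda>k. \<alpha> k + \<beta> k) = deg \<alpha> + deg \<beta>"
  by (simp add: deg_def sum.distrib)

lemma mon_zero [simp]: "mon (\<lambda>_. 0) = \<one>"
  unfolding monomial_def by (intro foldr_pow_zero) simp

text \<open>
  In \<open>mon \<alpha>\<close> the variables stand in increasing order, so multiplication by \<open>x i\<close> from the left
  stays a monomial as long as no variable with a smaller index occurs.
\<close>

lemma mon_bump:
  assumes i: "i < n" and z: "\<And>j. j < i \<Longrightarrow> \<alpha> j = 0"
  shows "mon (bump i \<alpha>) = x i \<otimes> mon \<alpha>"
proof -
  define tail where
    "tail = (\<lambda>\<beta> :: nat \<Rightarrow> nat. foldr (\<lambda>i m. (x i [^] \<beta> i) \<otimes> m) [Suc i..<n] \<one>)"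
  have split: "[0..<n] = [0..<i] @ i # [Suc i..<n]"
    using i upt_conv_Cons[of i n] upt_add_eq_append[of 0 i "n - i"] by simp
  have skip: "(\<And>j. j \<in> set js \<Longrightarrow> \<beta> j = 0) \<Longrightarrow> m \<in> carrier A \<Longrightarrow>
      foldr (\<lambda>i m. (x i [^] \<beta> i) \<otimes> m) js m = m" for js m and \<beta> :: "nat \<Rightarrow> nat"
    by (induction js) auto
  have closed: "set js \<subseteq> {..<n} \<Longrightarrow> foldr (\<lambda>i m. (x i [^] \<beta> i) \<otimes> m) js \<one> \<in> carrier A"
    for js and \<beta> :: "nat \<Rightarrow> nat"
    by (induction js) (auto simp: var_closed)
  have tail: "tail \<beta> \<in> carrier A" for \<beta>
    unfolding tail_def by (rule closed) auto
  have mon: "mon \<beta> = x i [^] \<beta> i \<otimes> tail \<beta>" if "\<And>j. j < i \<Longrightarrow> \<beta> j = 0" for \<beta>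
    using tail[of \<beta>] var_closed[OF i] that skip[of "[0..<i]" \<beta> "x i [^] \<beta> i \<otimes> tail \<beta>"]
    unfolding monomial_def split by (simp add: tail_def)
  have "tail (bump i \<alpha>) = tail \<alpha>"
    unfolding tail_def by (intro foldr_cong) (auto simp: bump_def)
  then have "mon (bump i \<alpha>) = x i [^] Suc (\<alpha> i) \<otimes> tail \<alpha>"
    using mon[of "bump i \<alpha>"] z by (simp add: bump_def)
  also have "\<dots> = (x i \<otimes> x i [^] \<alpha> i) \<otimes> tail \<alpha>"
    by (simp only: nat_pow_Suc2[OF var_closed[OF i]])
  also have "\<dots> = x i \<otimes> mon \<alpha>"
    using mon[of \<alpha>] z tail var_closed[OF i] by (simp add: m_assoc)
  finally show ?thesis .
qed

text \<open>
  A monomial is built from the right, adding variables in front of it in the only order for which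
  \<open>mon_bump\<close> applies.
\<close>

lemma MI_induct [consumes 1, case_names zero bump]:
  assumes "\<alpha> \<in> MI" "P (\<lambda>_. 0)"
    and "\<And>i \<alpha>. i < n \<Longrightarrow> \<alpha> \<in> MI \<Longrightarrow> (\<And>j. j < i \<Longrightarrow> \<alpha> j = 0) \<Longrightarrow> P \<alpha> \<Longrightarrow> P (bump i \<alpha>)"
  shows "P \<alpha>"
  using assms(1)
proof (induction "deg \<alpha>" arbitrary: \<alpha>)
  case 0
  then have "\<alpha> k = 0" for k
    by (cases "k < n") (auto simp: deg_def multi_indices_def)
  then have "\<alpha> = (\<lambda>_. 0)" by auto
  then show ?case using assms(2) by simp
next
  case (Suc m)
  obtain i where i: "\<alpha> i \<noteq> 0" "\<And>j. j < i \<Longrightarrow> \<alpha> j = 0"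
    using Suc(2) exists_least_iff[of "\<lambda>i. \<alpha> i \<noteq> 0"] by (auto simp: deg_def)
  have n: "i < n" using i Suc.prems by (auto simp: multi_indices_def) (metis not_less neq0_conv)
  define \<beta> where "\<beta> = \<alpha>(i := \<alpha> i - 1)"
  have eq: "\<alpha> = bump i \<beta>" using i by (auto simp: \<beta>_def bump_def)
  have "\<beta> \<in> MI" using Suc.prems by (auto simp: \<beta>_def multi_indices_def)
  moreover have "deg \<beta> = m" using Suc(2) deg_bump[OF n, of \<beta>] eq by simp
  moreover have "\<beta> j = 0" if "j < i" for j using i that by (simp add: \<beta>_def)
  ultimately show ?case unfolding eq using Suc(1) n assms(3) by blast
qed

definition below :: "nat \<Rightarrow> 'a set"
  where "below m = {a \<in> carrier A. \<forall>\<alpha>. m \<le> deg \<alpha> \<longrightarrow> coef a \<alpha> = \<zero>}"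

lemma belowD: "a \<in> below m \<Longrightarrow> a \<in> carrier A"
  by (simp add: below_def)

lemma below_zero [simp]: "\<zero> \<in> below m"
  by (simp add: below_def)

lemma below_add [simp]: "a \<in> below m \<Longrightarrow> b \<in> below m \<Longrightarrow> a \<oplus> b \<in> below m"
  by (auto simp: below_def)

lemma below_smult [simp]: "r \<in> R \<Longrightarrow> a \<in> below m \<Longrightarrow> r \<otimes> a \<in> below m"
  by (auto simp: below_def R_sub)

lemma below_mon [simp]: "\<alpha> \<in> MI \<Longrightarrow> deg \<alpha> < m \<Longrightarrow> mon \<alpha> \<in> below m"
  by (auto simp: below_def)

lemma below_mono: "a \<in> below k \<Longrightarrow> k \<le> m \<Longrightarrow> a \<in> below m"
  by (auto simp: below_def)

lemma var_eq_mon: "i < n \<Longrightarrow> x i = mon (bump i (\<lambda>_. 0))"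
  by (subst mon_bump) (auto simp: var_closed)

text \<open>
  The scalars that arise when monomials are sorted. One-sided invertibility suffices: modulo an ideal
  with reduced quotient, a left invertible element can be cancelled from the right (\<open>N_cancel\<close>).
\<close>

definition left_invertible :: "'a set"
  where "left_invertible = {d \<in> R. \<exists>e\<in>R. e \<otimes> d = \<one>}"

lemma left_invertible_R: "d \<in> left_invertible \<Longrightarrow> d \<in> R"
  by (simp add: left_invertible_def)

lemma left_invertible_one: "\<one> \<in> left_invertible"
  unfolding left_invertible_def using R_one l_one[OF one_closed] by blast

lemma left_invertible_mult:
  assumes "d \<in> left_invertible" "d' \<in> left_invertible"
  shows "d \<otimes> d' \<in> left_invertible"
proof -
  obtain e e' where e: "e \<in> R" "e' \<in> R" "e \<otimes> d = \<one>" "e' \<otimes> d' = \<one>"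
    using assms by (auto simp: left_invertible_def)
  have c: "e \<in> carrier A" "e' \<in> carrier A" "d \<in> carrier A" "d' \<in> carrier A" "d \<in> R" "d' \<in> R"
    using e assms by (auto simp: left_invertible_def R_sub)
  have "(e' \<otimes> e) \<otimes> (d \<otimes> d') = e' \<otimes> ((e \<otimes> d) \<otimes> d')" using c by (simp add: m_assoc)
  also have "\<dots> = \<one>" using c e by simp
  finally show ?thesis using c e by (auto simp: left_invertible_def R_mult)
qed

lemma linear_below:
  assumes "r \<in> R" "\<forall>k<n. s k \<in> R"
  shows "r \<oplus> (\<Oplus>k\<in>{..<n}. s k \<otimes> x k) \<in> below 2"
proof -
  have "r \<otimes> mon (\<lambda>_. 0) \<in> below 2" using assms by (intro below_smult below_mon) auto
  moreover have "(\<Oplus>k\<in>{..<n}. s k \<otimes> x k) \<in> below 2"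
    by (rule finsum_induct[where P = "\<lambda>p. p \<in> below 2"]) (use assms in \<open>auto simp: R_sub var_eq_mon\<close>)
  ultimately show ?thesis using assms by (simp add: R_sub)
qed

text \<open>
  The commutation scalars \<open>d\<close> and \<open>e\<close> with \<open>x\<^sub>ix\<^sub>j = d x\<^sub>jx\<^sub>i\<close> and \<open>x\<^sub>jx\<^sub>i = e x\<^sub>ix\<^sub>j\<close> up to terms of
  degree at most one satisfy \<open>ed = 1\<close>: substituting one commutation rule into the other gives \<open>x\<^sub>jx\<^sub>i = ed x\<^sub>jx\<^sub>i\<close> up to terms of
  degree at most one, and \<open>x\<^sub>jx\<^sub>i\<close> is a basis element.
\<close>

lemma var_swap:
  assumes ji: "j < i" and i: "i < n"
  obtains d r s where "d \<in> left_invertible" "r \<in> R" "\<forall>k<n. s k \<in> R"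
    "x i \<otimes> x j = d \<otimes> (x j \<otimes> x i) \<oplus> (r \<oplus> (\<Oplus>k\<in>{..<n}. s k \<otimes> x k))"
proof -
  note xi = var_closed[OF i] and xj = var_closed[OF less_trans[OF ji i]]
  obtain d r s where d: "d \<in> R" and rs: "r \<in> R" "\<forall>k<n. s k \<in> R"
    and ed: "x i \<otimes> x j \<ominus> d \<otimes> x j \<otimes> x i = r \<oplus> (\<Oplus>k\<in>{..<n}. s k \<otimes> x k)"
    using var_var[of j i] ji i by auto
  obtain e r' s' where e: "e \<in> R" and rs': "r' \<in> R" "\<forall>k<n. s' k \<in> R"
    and ee: "x j \<otimes> x i \<ominus> e \<otimes> x i \<otimes> x j = r' \<oplus> (\<Oplus>k\<in>{..<n}. s' k \<otimes> x k)"
    using var_var[of i j] ji i by auto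
  define l where "l = r \<oplus> (\<Oplus>k\<in>{..<n}. s k \<otimes> x k)"
  define l' where "l' = r' \<oplus> (\<Oplus>k\<in>{..<n}. s' k \<otimes> x k)"
  have l: "l \<in> below 2" "l' \<in> below 2"
    using linear_below rs rs' by (auto simp: l_def l'_def)
  note lc = belowD[OF l(1)] belowD[OF l(2)]
  have c: "d \<in> carrier A" "e \<in> carrier A" using d e by (auto simp: R_sub)
  have 1: "x i \<otimes> x j = d \<otimes> (x j \<otimes> x i) \<oplus> l"
    unfolding l_def ed[symmetric] using c xi xj by algebra
  have 2: "x j \<otimes> x i = e \<otimes> (x i \<otimes> x j) \<oplus> l'"
    unfolding l'_def ee[symmetric] using c xi xj by algebra
  define \<beta> where "\<beta> = bump j (bump i (\<lambda>_. 0))"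
  have \<beta>: "\<beta> \<in> MI" "deg \<beta> = 2" using ji i by (auto simp: \<beta>_def)
  have m: "x j \<otimes> x i = mon \<beta>"
    unfolding \<beta>_def using ji i by (subst mon_bump) (auto simp: var_eq_mon bump_def)
  have "mon \<beta> = (e \<otimes> d) \<otimes> mon \<beta> \<oplus> (e \<otimes> l \<oplus> l')"
    using 2 unfolding 1 unfolding m using c lc by (simp add: r_distr m_assoc a_assoc)
  then have "coef (mon \<beta>) \<beta> = coef ((e \<otimes> d) \<otimes> mon \<beta> \<oplus> (e \<otimes> l \<oplus> l')) \<beta>" by simp
  also have "\<dots> = e \<otimes> d \<oplus> coef (e \<otimes> l \<oplus> l') \<beta>"
    using c lc d e \<beta> by (subst coef_add) (auto simp: R_mult)
  also have "coef (e \<otimes> l \<oplus> l') \<beta> = \<zero>"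
    using below_add[OF below_smult[OF e l(1)] l(2)] \<beta> unfolding below_def by auto
  finally have "e \<otimes> d = \<one>" using \<beta> c by simp
  then have "d \<in> left_invertible" using d e by (auto simp: left_invertible_def)
  with that[OF this rs] 1 show ?thesis by (simp add: l_def)
qed

end

locale skew_PBW_maps = skew_PBW_extension A R n x for A (structure) and R n x +
  fixes \<sigma> \<delta> :: "nat \<Rightarrow> 'a \<Rightarrow> 'a"
  assumes maps: "structure_maps A R n x \<sigma> \<delta>"
begin

lemma sigma_closed: "i < n \<Longrightarrow> r \<in> R \<Longrightarrow> \<sigma> i r \<in> R"
  and delta_closed: "i < n \<Longrightarrow> r \<in> R \<Longrightarrow> \<delta> i r \<in> R"
  and sigma_mult: "i < n \<Longrightarrow> r \<in> R \<Longrightarrow> s \<in> R \<Longrightarrow> \<sigma> i (r \<otimes> s) = \<sigma> i r \<otimes> \<sigma> i s"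
  and sigma_one: "i < n \<Longrightarrow> \<sigma> i \<one> = \<one>"
  and delta_mult: "i < n \<Longrightarrow> r \<in> R \<Longrightarrow> s \<in> R \<Longrightarrow> \<delta> i (r \<otimes> s) = \<sigma> i r \<otimes> \<delta> i s \<oplus> \<delta> i r \<otimes> s"
  and var_scalar: "i < n \<Longrightarrow> r \<in> R \<Longrightarrow> x i \<otimes> r = \<sigma> i r \<otimes> x i \<oplus> \<delta> i r"
  using maps unfolding structure_maps_def ring_hom_def is_derivation_def by auto

lemma var_term:
  assumes i: "i < n" and r: "r \<in> R" and a: "a \<in> carrier A"
  shows "x i \<otimes> (r \<otimes> a) = \<sigma> i r \<otimes> (x i \<otimes> a) \<oplus> \<delta> i r \<otimes> a"
proof -
  have c: "r \<in> carrier A" "\<sigma> i r \<in> carrier A" "\<delta> i r \<in> carrier A" "x i \<in> carrier A"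
    using i r by (auto simp: R_sub sigma_closed delta_closed var_closed)
  have "x i \<otimes> (r \<otimes> a) = (x i \<otimes> r) \<otimes> a" using a c by (simp add: m_assoc)
  also have "\<dots> = \<sigma> i r \<otimes> (x i \<otimes> a) \<oplus> \<delta> i r \<otimes> a"
    unfolding var_scalar[OF i r] using a c by (simp add: l_distr m_assoc)
  finally show ?thesis .
qed

lemma sigma_left_invertible:
  assumes i: "i < n" and d: "d \<in> left_invertible"
  shows "\<sigma> i d \<in> left_invertible"
proof -
  obtain e where e: "e \<in> R" "e \<otimes> d = \<one>" and dR: "d \<in> R"
    using d by (auto simp: left_invertible_def)
  have "\<sigma> i e \<otimes> \<sigma> i d = \<one>"
    using sigma_mult[OF i e(1) dR] e(2) sigma_one[OF i] by simp
  then show ?thesis using sigma_closed[OF i] e(1) dR by (auto simp: left_invertible_def)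
qed

text \<open>
  Multiplication by a variable raises the degree by at most one, provided that it does so on the
  monomials that can occur. The proviso makes the lemma usable inside the induction on the degree that
  proves it for all monomials.
\<close>

lemma var_below_step:
  assumes i: "i < n" and p: "p \<in> below m"
    and step: "\<And>\<alpha>. \<alpha> \<in> MI \<Longrightarrow> deg \<alpha> < m \<Longrightarrow> x i \<otimes> mon \<alpha> \<in> below (Suc m)"
  shows "x i \<otimes> p \<in> below (Suc m)"
proof (rule term_induct[where P = "\<lambda>p. x i \<otimes> p \<in> below (Suc m)", OF belowD[OF p]])
  show "x i \<otimes> \<zero> \<in> below (Suc m)" using var_closed[OF i] by simp
next
  fix p q assume "p \<in> carrier A" "q \<in> carrier A"
    "x i \<otimes> p \<in> below (Suc m)" "x i \<otimes> q \<in> below (Suc m)"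
  then show "x i \<otimes> (p \<oplus> q) \<in> below (Suc m)" using var_closed[OF i] by (simp add: r_distr)
next
  fix \<alpha> assume \<alpha>: "\<alpha> \<in> MI" "coef p \<alpha> \<noteq> \<zero>"
  then have "deg \<alpha> < m" using p by (auto simp: below_def not_le[symmetric])
  with \<alpha> show "x i \<otimes> (coef p \<alpha> \<otimes> mon \<alpha>) \<in> below (Suc m)"
    using i step coef_closed[OF belowD[OF p]]
    by (simp add: var_term sigma_closed delta_closed)
qed

text \<open>
  By induction on the degree. Let \<open>j\<close> be the least index with \<open>\<alpha> j \<noteq> 0\<close>. If \<open>i \<le> j\<close> the product is a monomial.
  Otherwise write \<open>x\<^sup>\<alpha> = x\<^sub>j x\<^sup>\<gamma>\<close>, swap \<open>x\<^sub>i\<close> with \<open>x\<^sub>j\<close>, apply the induction hypothesis to \<open>x\<^sub>i x\<^sup>\<gamma>\<close>,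
  and move \<open>x\<^sub>j\<close> past the resulting scalar; no variable of smaller index than \<open>j\<close> occurs behind it, so
  the result is sorted.
\<close>

lemma var_mon_leading:
  assumes "\<alpha> \<in> MI" "i < n"
  shows "\<exists>d\<in>left_invertible. \<exists>p\<in>below (Suc (deg \<alpha>)). x i \<otimes> mon \<alpha> = d \<otimes> mon (bump i \<alpha>) \<oplus> p"
  using assms
proof (induction "deg \<alpha>" arbitrary: \<alpha> i rule: less_induct)
  case less
  note i = less.prems(2)
  have mon_step: "x k \<otimes> mon \<gamma> \<in> below (Suc m)"
    if \<gamma>: "\<gamma> \<in> MI" "deg \<gamma> < m" "m \<le> deg \<alpha>" and k: "k < n" for k \<gamma> m
  proof -
    obtain d p where "d \<in> left_invertible" "p \<in> below (Suc (deg \<gamma>))"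
      "x k \<otimes> mon \<gamma> = d \<otimes> mon (bump k \<gamma>) \<oplus> p"
      using less.hyps[of \<gamma> k] \<gamma> k by auto
    then show ?thesis
      using \<gamma> k by (auto simp: left_invertible_R intro!: below_add below_smult intro: below_mono)
  qed
  show ?case
  proof (cases "\<forall>j<i. \<alpha> j = 0")
    case True
    then have "x i \<otimes> mon \<alpha> = \<one> \<otimes> mon (bump i \<alpha>) \<oplus> \<zero>"
      using mon_bump[of i \<alpha>] i var_closed[OF i] by simp
    then show ?thesis using left_invertible_one below_zero by blast
  next
    case False
    obtain j where j: "\<alpha> j \<noteq> 0" "\<And>k. k < j \<Longrightarrow> \<alpha> k = 0"
      using False exists_least_iff[of "\<lambda>j. \<alpha> j \<noteq> 0"] by auto
    have ji: "j < i"
    proof (rule ccontr)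
      assume "\<not> j < i"
      then have "\<alpha> k = 0" if "k < i" for k using j(2)[of k] that by simp
      with False show False by blast
    qed
    have jn: "j < n" using ji i by simp
    define \<gamma> where "\<gamma> = \<alpha>(j := \<alpha> j - 1)"
    have \<alpha>: "\<alpha> = bump j \<gamma>" using j by (auto simp: \<gamma>_def bump_def)
    have \<gamma>: "\<gamma> \<in> MI" using less.prems by (auto simp: \<gamma>_def multi_indices_def)
    have \<gamma>0: "\<And>k. k < j \<Longrightarrow> \<gamma> k = 0" using j by (simp add: \<gamma>_def)
    have deg: "deg \<alpha> = Suc (deg \<gamma>)" unfolding \<alpha> using jn by simp
    define \<beta> where "\<beta> = bump i \<gamma>"
    have \<beta>: "\<beta> \<in> MI" "deg \<beta> = deg \<alpha>" using i \<gamma> deg by (auto simp: \<beta>_def)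
    have \<beta>0: "\<And>k. k < j \<Longrightarrow> \<beta> k = 0" using \<gamma>0 ji by (simp add: \<beta>_def bump_def)
    have \<beta>\<alpha>: "bump j \<beta> = bump i \<alpha>" using ji by (auto simp: \<alpha> \<beta>_def bump_def)
    obtain d r s where d: "d \<in> left_invertible" and rs: "r \<in> R" "\<forall>k<n. s k \<in> R"
      and swap: "x i \<otimes> x j = d \<otimes> (x j \<otimes> x i) \<oplus> (r \<oplus> (\<Oplus>k\<in>{..<n}. s k \<otimes> x k))"
      using var_swap[OF ji i] .
    define l where "l = r \<oplus> (\<Oplus>k\<in>{..<n}. s k \<otimes> x k)"
    obtain e p where e: "e \<in> left_invertible" and p: "p \<in> below (deg \<alpha>)"
      and ep: "x i \<otimes> mon \<gamma> = e \<otimes> mon \<beta> \<oplus> p"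
      using less.hyps[of \<gamma> i] deg \<gamma> i by (auto simp: \<beta>_def)
    have lin: "(\<Oplus>k\<in>{..<n}. s k \<otimes> x k) \<in> {q \<in> carrier A. q \<otimes> mon \<gamma> \<in> below (Suc (deg \<alpha>))}"
    proof (rule finsum_induct[where P = "\<lambda>q. q \<in> {q \<in> carrier A. q \<otimes> mon \<gamma> \<in> below (Suc (deg \<alpha>))}"])
      fix k assume k: "k \<in> {..<n}"
      have "(s k \<otimes> x k) \<otimes> mon \<gamma> = s k \<otimes> (x k \<otimes> mon \<gamma>)"
        using k rs var_closed by (simp add: m_assoc R_sub)
      then show "s k \<otimes> x k \<in> {q \<in> carrier A. q \<otimes> mon \<gamma> \<in> below (Suc (deg \<alpha>))}"
        using k rs mon_step[OF \<gamma> _ order_refl, of k] deg var_closed by (auto simp: R_sub)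
    qed (use rs var_closed in \<open>auto simp: R_sub l_distr\<close>)
    have l: "l \<in> carrier A" "l \<otimes> mon \<gamma> \<in> below (Suc (deg \<alpha>))"
      using lin rs \<gamma> deg by (auto simp: l_def R_sub l_distr)
    have c: "d \<in> carrier A" "e \<in> carrier A" "\<sigma> j e \<in> carrier A" "\<delta> j e \<in> carrier A"
      "p \<in> carrier A" "x i \<in> carrier A" "x j \<in> carrier A"
      using d e p i jn
      by (auto simp: left_invertible_R R_sub sigma_closed delta_closed var_closed belowD)
    define q where "q = d \<otimes> (\<delta> j e \<otimes> mon \<beta> \<oplus> x j \<otimes> p) \<oplus> l \<otimes> mon \<gamma>"
    have "x i \<otimes> mon \<alpha> = (x i \<otimes> x j) \<otimes> mon \<gamma>"
      unfolding \<alpha> using mon_bump[of j \<gamma>] jn \<gamma>0 c by (simp add: m_assoc)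
    also have "\<dots> = d \<otimes> (x j \<otimes> (x i \<otimes> mon \<gamma>)) \<oplus> l \<otimes> mon \<gamma>"
      unfolding swap l_def[symmetric] using c l by (simp add: l_distr m_assoc)
    also have "x j \<otimes> (x i \<otimes> mon \<gamma>) = x j \<otimes> (e \<otimes> mon \<beta>) \<oplus> x j \<otimes> p"
      unfolding ep using c by (simp add: r_distr)
    also have "x j \<otimes> (e \<otimes> mon \<beta>) = \<sigma> j e \<otimes> mon (bump i \<alpha>) \<oplus> \<delta> j e \<otimes> mon \<beta>"
      using var_term[OF jn left_invertible_R[OF e], of "mon \<beta>"] mon_bump[of j \<beta>] jn \<beta>0 \<beta>\<alpha>
      by simp
    finally have eq: "x i \<otimes> mon \<alpha> = (d \<otimes> \<sigma> j e) \<otimes> mon (bump i \<alpha>) \<oplus> q"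
      unfolding q_def using c l by (simp add: r_distr m_assoc a_assoc)
    have "x j \<otimes> p \<in> below (Suc (deg \<alpha>))"
      using var_below_step[OF jn p] mon_step[OF _ _ order_refl jn] by blast
    then have "q \<in> below (Suc (deg \<alpha>))"
      unfolding q_def using d e \<beta> l jn
      by (auto intro!: below_add below_smult simp: left_invertible_R delta_closed)
    moreover have "d \<otimes> \<sigma> j e \<in> left_invertible"
      using d e jn left_invertible_mult sigma_left_invertible by blast
    ultimately show ?thesis using eq by blast
  qed
qed

lemma var_below:
  assumes i: "i < n" and p: "p \<in> below m"
  shows "x i \<otimes> p \<in> below (Suc m)"
proof (rule var_below_step[OF i p])
  fix \<alpha> assume \<alpha>: "\<alpha> \<in> MI" "deg \<alpha> < m"
  obtain d p where "d \<in> left_invertible" "p \<in> below (Suc (deg \<alpha>))"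
    "x i \<otimes> mon \<alpha> = d \<otimes> mon (bump i \<alpha>) \<oplus> p"
    using var_mon_leading[OF \<alpha>(1) i] by auto
  then show "x i \<otimes> mon \<alpha> \<in> below (Suc m)"
    using \<alpha> i by (auto simp: left_invertible_R intro!: below_add below_smult intro: below_mono)
qed

end

section \<open>Coefficients in a stable right ideal\<close>

context skew_PBW_maps
begin

text \<open>
  For a right ideal \<open>K\<close> of \<open>R\<close> preserved by all structure maps, the elements of \<open>A\<close> with
  coefficients in \<open>K\<close> are closed under multiplication by monomials from the left (\<open>coefs_in_mon\<close>).
\<close>

definition stable :: "'a set \<Rightarrow> bool"
  where "stable K \<longleftrightarrow> K \<subseteq> R \<and> \<zero> \<in> K \<and> (\<forall>a\<in>K. \<forall>b\<in>K. a \<oplus> b \<in> K) \<and>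
    (\<forall>a\<in>K. \<forall>r\<in>R. a \<otimes> r \<in> K) \<and> (\<forall>i<n. \<forall>a\<in>K. \<sigma> i a \<in> K \<and> \<delta> i a \<in> K)"

definition coefs_in :: "'a set \<Rightarrow> 'a set"
  where "coefs_in K = {a \<in> carrier A. \<forall>\<alpha>. coef a \<alpha> \<in> K}"

lemma coefs_in_carrier: "a \<in> coefs_in K \<Longrightarrow> a \<in> carrier A"
  by (simp add: coefs_in_def)

lemma coefs_in_zero: "stable K \<Longrightarrow> \<zero> \<in> coefs_in K"
  by (simp add: coefs_in_def stable_def)

lemma coefs_in_add: "stable K \<Longrightarrow> a \<in> coefs_in K \<Longrightarrow> b \<in> coefs_in K \<Longrightarrow> a \<oplus> b \<in> coefs_in K"
  by (auto simp: coefs_in_def stable_def)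

lemma coefs_in_scalar:
  assumes "stable K" "k \<in> K" "a \<in> carrier A"
  shows "k \<otimes> a \<in> coefs_in K"
proof -
  have "k \<in> R" using assms by (auto simp: stable_def)
  then show ?thesis using assms by (auto simp: coefs_in_def stable_def coef_closed R_sub)
qed

lemma coefs_in_var:
  assumes K: "stable K" and a: "a \<in> coefs_in K" and i: "i < n"
  shows "x i \<otimes> a \<in> coefs_in K"
proof (rule term_induct[where P = "\<lambda>a. x i \<otimes> a \<in> coefs_in K", OF coefs_in_carrier[OF a]])
  fix \<alpha>
  have k: "coef a \<alpha> \<in> K" using a by (simp add: coefs_in_def)
  then have kR: "coef a \<alpha> \<in> R" "\<sigma> i (coef a \<alpha>) \<in> K" "\<delta> i (coef a \<alpha>) \<in> K"
    using K i by (auto simp: stable_def)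
  then show "x i \<otimes> (coef a \<alpha> \<otimes> mon \<alpha>) \<in> coefs_in K"
    using var_term[OF i kR(1), of "mon \<alpha>"] var_closed[OF i]
    by (auto intro!: coefs_in_add coefs_in_scalar K)
qed (use var_closed[OF i] coefs_in_zero[OF K] coefs_in_add[OF K] in \<open>auto simp: r_distr\<close>)

lemma coefs_in_mon:
  assumes K: "stable K" and a: "a \<in> coefs_in K" and \<gamma>: "\<gamma> \<in> MI"
  shows "mon \<gamma> \<otimes> a \<in> coefs_in K"
  using \<gamma>
proof (induction rule: MI_induct)
  case zero
  then show ?case using a coefs_in_carrier[OF a] by simp
next
  case (bump i \<alpha>)
  then show ?case
    using coefs_in_var[OF K bump.IH bump.hyps(1)] mon_bump[of i \<alpha>] var_closed coefs_in_carrier[OF a]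
    by (simp add: m_assoc)
qed

text \<open>
  The factor \<open>c\<close> stands leftmost in each coefficient, so it can be taken out of a left linear
  combination of monomials.
\<close>

lemma principal_coefs:
  assumes c: "c \<in> R"
  shows "coefs_in {c \<otimes> r | r. r \<in> R} = {c \<otimes> a | a. a \<in> carrier A}"
proof
  show "{c \<otimes> a | a. a \<in> carrier A} \<subseteq> coefs_in {c \<otimes> r | r. r \<in> R}"
    using c by (auto simp: coefs_in_def R_sub coef_closed)
  show "coefs_in {c \<otimes> r | r. r \<in> R} \<subseteq> {c \<otimes> a | a. a \<in> carrier A}"
  proof
    fix f assume "f \<in> coefs_in {c \<otimes> r | r. r \<in> R}"
    then have f: "f \<in> carrier A" and cf: "\<And>\<alpha>. \<exists>r\<in>R. coef f \<alpha> = c \<otimes> r"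
      by (auto simp: coefs_in_def)
    have cc: "c \<in> carrier A" using c by (rule R_sub)
    show "f \<in> {c \<otimes> a | a. a \<in> carrier A}"
    proof (rule term_induct[where P = "\<lambda>f. f \<in> {c \<otimes> a | a. a \<in> carrier A}", OF f])
      have "\<zero> = c \<otimes> \<zero>" using cc by simp
      then show "\<zero> \<in> {c \<otimes> a | a. a \<in> carrier A}" by blast
    next
      fix p q assume "p \<in> {c \<otimes> a | a. a \<in> carrier A}" "q \<in> {c \<otimes> a | a. a \<in> carrier A}"
      then obtain a b where ab: "a \<in> carrier A" "b \<in> carrier A" "p = c \<otimes> a" "q = c \<otimes> b" by auto
      then have "p \<oplus> q = c \<otimes> (a \<oplus> b)" using cc by (simp add: r_distr)
      then show "p \<oplus> q \<in> {c \<otimes> a | a. a \<in> carrier A}" using ab by blast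
    next
      fix \<alpha>
      obtain r where r: "r \<in> R" "coef f \<alpha> = c \<otimes> r" using cf by blast
      then have "coef f \<alpha> \<otimes> mon \<alpha> = c \<otimes> (r \<otimes> mon \<alpha>)" using cc by (simp add: m_assoc R_sub)
      then show "coef f \<alpha> \<otimes> mon \<alpha> \<in> {c \<otimes> a | a. a \<in> carrier A}"
        using m_closed[OF R_sub[OF r(1)] mon_closed] by blast
    qed
  qed
qed

end

section \<open>Products modulo a compatible ideal\<close>

text \<open>
  An ideal \<open>N\<close> of \<open>R\<close> such that \<open>R/N\<close> is reduced and compatible with the structure maps.
  Working with membership in \<open>N\<close> replaces passing to the quotient extension over \<open>R/N\<close>.
\<close>

locale compatible_ideal = skew_PBW_maps A R n x \<sigma> \<delta> for A (structure) and R n x \<sigma> \<delta> +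
  fixes N
  assumes N_R: "N \<subseteq> R"
    and N_zero: "\<zero> \<in> N"
    and N_add: "a \<in> N \<Longrightarrow> b \<in> N \<Longrightarrow> a \<oplus> b \<in> N"
    and N_right: "a \<in> N \<Longrightarrow> r \<in> R \<Longrightarrow> a \<otimes> r \<in> N"
    and N_left: "a \<in> N \<Longrightarrow> r \<in> R \<Longrightarrow> r \<otimes> a \<in> N"
    and N_square: "a \<in> R \<Longrightarrow> a \<otimes> a \<in> N \<Longrightarrow> a \<in> N"
    and N_sigma: "i < n \<Longrightarrow> a \<in> R \<Longrightarrow> b \<in> R \<Longrightarrow> a \<otimes> \<sigma> i b \<in> N \<longleftrightarrow> a \<otimes> b \<in> N"
    and N_delta: "i < n \<Longrightarrow> a \<in> R \<Longrightarrow> b \<in> R \<Longrightarrow> a \<otimes> b \<in> N \<Longrightarrow> a \<otimes> \<delta> i b \<in> N"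
begin

lemma N_swap:
  assumes a: "a \<in> R" and b: "b \<in> R" and ab: "a \<otimes> b \<in> N"
  shows "b \<otimes> a \<in> N"
proof (rule N_square)
  have "b \<otimes> (a \<otimes> b) \<otimes> a \<in> N" using a b ab N_left N_right by auto
  then show "(b \<otimes> a) \<otimes> (b \<otimes> a) \<in> N" using a b by (simp add: m_assoc R_sub)
qed (use a b R_mult in auto)

lemma N_cancel:
  assumes a: "a \<in> R" and d: "d \<in> left_invertible" and ad: "a \<otimes> d \<in> N"
  shows "a \<in> N"
proof -
  obtain e where e: "e \<in> R" "e \<otimes> d = \<one>" and dR: "d \<in> R"
    using d by (auto simp: left_invertible_def)
  have "e \<otimes> (d \<otimes> a) \<in> N" using N_left[OF N_swap[OF a dR ad] e(1)] .
  then show ?thesis using e a dR by (simp add: m_assoc[symmetric] R_sub)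
qed

lemma stable_annihilator:
  assumes a: "a \<in> R"
  shows "stable {b \<in> R. a \<otimes> b \<in> N}"
  unfolding stable_def
  using a N_zero N_sigma N_delta N_right sigma_closed delta_closed
  by (auto simp: R_add R_mult R_zero R_sub r_distr m_assoc[symmetric] intro!: N_add)

lemma stable_N: "stable N"
proof -
  have "{b \<in> R. \<one> \<otimes> b \<in> N} = N" using N_R by (auto simp: R_sub)
  then show ?thesis using stable_annihilator[OF R_one] by simp
qed

lemma coefs_in_N_minus:
  assumes "a \<in> coefs_in N"
  shows "\<ominus> a \<in> coefs_in N"
proof -
  have "\<ominus> coef a \<alpha> \<in> N" for \<alpha>
    using assms N_left[of "coef a \<alpha>" "\<ominus> \<one>"] R_minus[OF R_one]
    by (auto simp: coefs_in_def l_minus)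
  then show ?thesis using assms by (auto simp: coefs_in_def)
qed

lemma coefs_in_N_left:
  assumes r: "r \<in> R" and a: "a \<in> coefs_in N"
  shows "r \<otimes> a \<in> coefs_in N"
  using assms N_left by (auto simp: coefs_in_def R_sub)

text \<open>
  For a coefficient \<open>a\<close> of \<open>u\<close>, the coefficients of \<open>f\<close> lie in the stable right ideal
  \<open>{b. ab \<in> N}\<close>; hence so do those of \<open>x\<^sup>\<alpha> f\<close>, and multiplying by \<open>a\<close> moves them into \<open>N\<close>.
\<close>

lemma mult_coefs_in_N:
  assumes u: "u \<in> carrier A" and f: "f \<in> carrier A"
    and uf: "\<And>\<alpha> \<beta>. coef u \<alpha> \<otimes> coef f \<beta> \<in> N"
  shows "u \<otimes> f \<in> coefs_in N"
proof (rule term_induct[where P = "\<lambda>u. u \<otimes> f \<in> coefs_in N", OF u])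
  fix \<alpha> assume \<alpha>: "\<alpha> \<in> MI"
  let ?K = "{b \<in> R. coef u \<alpha> \<otimes> b \<in> N}"
  have K: "stable ?K" using stable_annihilator coef_closed[OF u] .
  have "f \<in> coefs_in ?K" using f uf by (simp add: coefs_in_def coef_closed)
  then have g: "mon \<alpha> \<otimes> f \<in> coefs_in ?K" using coefs_in_mon[OF K _ \<alpha>] by simp
  then have "coef u \<alpha> \<otimes> (mon \<alpha> \<otimes> f) \<in> coefs_in N"
    using u by (simp add: coefs_in_def coef_closed)
  then show "(coef u \<alpha> \<otimes> mon \<alpha>) \<otimes> f \<in> coefs_in N" using u f by (simp add: m_assoc)
qed (use f coefs_in_zero[OF stable_N] coefs_in_add[OF stable_N] in \<open>auto simp: l_distr\<close>)

text \<open>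
  The coefficient \<open>b'\<close> arises from \<open>b\<close> by applying maps \<open>\<sigma>\<^sub>i\<close> and multiplying by left invertible scalars
  from the right. Neither changes for which \<open>a\<close> the product \<open>ab\<close> lies in \<open>N\<close>, and nothing more
  about \<open>b'\<close> enters the comparison of leading terms.
\<close>

lemma mult_term_leading:
  assumes \<gamma>: "\<gamma> \<in> MI" and \<epsilon>: "\<epsilon> \<in> MI" and b: "b \<in> R"
  shows "\<exists>b'\<in>R. (\<forall>a\<in>R. a \<otimes> b' \<in> N \<longleftrightarrow> a \<otimes> b \<in> N) \<and>
    (\<exists>p\<in>below (deg \<gamma> + deg \<epsilon>). mon \<gamma> \<otimes> (b \<otimes> mon \<epsilon>) = b' \<otimes> mon (\<lambda>k. \<gamma> k + \<epsilon> k) \<oplus> p)"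
  using \<gamma>
proof (induction rule: MI_induct)
  case zero
  have "mon (\<lambda>_. 0) \<otimes> (b \<otimes> mon \<epsilon>) = b \<otimes> mon (\<lambda>k. 0 + \<epsilon> k) \<oplus> \<zero>" using b by (simp add: R_sub)
  then show ?case using b below_zero by blast
next
  case (bump i \<gamma>)
  note i = bump.hyps(1)
  define \<zeta> where "\<zeta> = (\<lambda>k. \<gamma> k + \<epsilon> k)"
  have \<zeta>: "\<zeta> \<in> MI" "deg \<zeta> = deg \<gamma> + deg \<epsilon>" using bump \<epsilon> by (auto simp: \<zeta>_def deg_add)
  obtain b' p where b': "b' \<in> R" "\<forall>a\<in>R. a \<otimes> b' \<in> N \<longleftrightarrow> a \<otimes> b \<in> N"
    and p: "p \<in> below (deg \<zeta>)" and eq: "mon \<gamma> \<otimes> (b \<otimes> mon \<epsilon>) = b' \<otimes> mon \<zeta> \<oplus> p"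
    using bump.IH unfolding \<zeta>_def[symmetric] \<zeta>(2) by blast
  obtain d q where d: "d \<in> left_invertible" and q: "q \<in> below (Suc (deg \<zeta>))"
    and dq: "x i \<otimes> mon \<zeta> = d \<otimes> mon (bump i \<zeta>) \<oplus> q"
    using var_mon_leading[OF \<zeta>(1) i] by blast
  note s = sigma_closed[OF i b'(1)] delta_closed[OF i b'(1)] left_invertible_R[OF d]
  note c = s[THEN R_sub] R_sub[OF b] R_sub[OF b'(1)] belowD[OF p] belowD[OF q] var_closed[OF i]
  define q' where "q' = (\<sigma> i b' \<otimes> q \<oplus> \<delta> i b' \<otimes> mon \<zeta>) \<oplus> x i \<otimes> p"
  have "mon (bump i \<gamma>) \<otimes> (b \<otimes> mon \<epsilon>) = x i \<otimes> (mon \<gamma> \<otimes> (b \<otimes> mon \<epsilon>))"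
    using mon_bump[OF i, of \<gamma>] bump c by (simp add: m_assoc)
  also have "\<dots> = x i \<otimes> (b' \<otimes> mon \<zeta>) \<oplus> x i \<otimes> p"
    unfolding eq using c by (simp add: r_distr)
  also have "x i \<otimes> (b' \<otimes> mon \<zeta>) = \<sigma> i b' \<otimes> (d \<otimes> mon (bump i \<zeta>) \<oplus> q) \<oplus> \<delta> i b' \<otimes> mon \<zeta>"
    using var_term[OF i b'(1), of "mon \<zeta>"] dq by simp
  finally have "mon (bump i \<gamma>) \<otimes> (b \<otimes> mon \<epsilon>) = (\<sigma> i b' \<otimes> d) \<otimes> mon (bump i \<zeta>) \<oplus> q'"
    unfolding q'_def using c by (simp add: r_distr m_assoc a_assoc)
  moreover have "q' \<in> below (deg (bump i \<gamma>) + deg \<epsilon>)"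
    unfolding q'_def using var_below[OF i p] q s \<zeta> i by auto
  moreover have "a \<otimes> (\<sigma> i b' \<otimes> d) \<in> N \<longleftrightarrow> a \<otimes> b \<in> N" if a: "a \<in> R" for a
  proof -
    have "a \<otimes> (\<sigma> i b' \<otimes> d) = (a \<otimes> \<sigma> i b') \<otimes> d" using R_sub[OF a] c by (simp add: m_assoc)
    then have "a \<otimes> (\<sigma> i b' \<otimes> d) \<in> N \<longleftrightarrow> a \<otimes> \<sigma> i b' \<in> N"
      using N_cancel[OF R_mult[OF a s(1)] d] N_right[OF _ s(3)] by auto
    then show ?thesis using N_sigma[OF i a b'(1)] b'(2) a by auto
  qed
  ultimately show ?case
    unfolding bump_add \<zeta>_def[symmetric] using R_mult[OF s(1,3)] by blast
qed

end

section \<open>Leading terms\<close>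

context skew_PBW_extension
begin

text \<open>
  A monomial order that refines the total degree. The correction terms of a product of monomials
  have smaller total degree, hence are smaller in this order, and within one degree the
  lexicographic comparison separates the terms of a product.
\<close>

definition deglex :: "(nat \<Rightarrow> nat) \<Rightarrow> (nat \<Rightarrow> nat) \<Rightarrow> bool"
  where "deglex \<alpha> \<beta> \<longleftrightarrow> deg \<alpha> < deg \<beta> \<or>
    deg \<alpha> = deg \<beta> \<and> (\<exists>k. \<alpha> k < \<beta> k \<and> (\<forall>j<k. \<alpha> j = \<beta> j))"

lemma deglex_total: "\<alpha> \<noteq> \<beta> \<Longrightarrow> deglex \<alpha> \<beta> \<or> deglex \<beta> \<alpha>"
proof -
  assume "\<alpha> \<noteq> \<beta>"
  then have "\<exists>k. \<alpha> k \<noteq> \<beta> k" by auto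
  then obtain k where "\<alpha> k \<noteq> \<beta> k" "\<forall>j<k. \<alpha> j = \<beta> j"
    using exists_least_iff[of "\<lambda>k. \<alpha> k \<noteq> \<beta> k"] by auto
  then have "\<alpha> k < \<beta> k \<and> (\<forall>j<k. \<alpha> j = \<beta> j) \<or> \<beta> k < \<alpha> k \<and> (\<forall>j<k. \<beta> j = \<alpha> j)" by auto
  then show ?thesis unfolding deglex_def using linorder_less_linear[of "deg \<alpha>" "deg \<beta>"] by metis
qed

lemma deglex_add:
  assumes "deglex \<alpha> \<beta>" "deglex \<gamma> \<epsilon> \<or> \<gamma> = \<epsilon>"
  shows "deglex (\<lambda>k. \<alpha> k + \<gamma> k) (\<lambda>k. \<beta> k + \<epsilon> k)"
proof (cases "deg \<alpha> = deg \<beta> \<and> deg \<gamma> = deg \<epsilon>")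
  case True
  then obtain k where k: "\<alpha> k < \<beta> k" "\<forall>j<k. \<alpha> j = \<beta> j" using assms by (auto simp: deglex_def)
  consider "\<gamma> = \<epsilon>" | m where "\<gamma> m < \<epsilon> m" "\<forall>j<m. \<gamma> j = \<epsilon> j"
    using True assms by (auto simp: deglex_def)
  then have "\<exists>k. \<alpha> k + \<gamma> k < \<beta> k + \<epsilon> k \<and> (\<forall>j<k. \<alpha> j + \<gamma> j = \<beta> j + \<epsilon> j)"
  proof cases
    case 1
    then show ?thesis using k by auto
  next
    case 2
    then have "\<alpha> (min k m) + \<gamma> (min k m) < \<beta> (min k m) + \<epsilon> (min k m)"
      using k by (cases k m rule: linorder_cases) (auto simp: min_def)
    then show ?thesis using k 2 by (intro exI[of _ "min k m"]) auto
  qed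
  then show ?thesis using True by (simp add: deglex_def deg_add)
next
  case False
  then show ?thesis using assms by (auto simp: deglex_def deg_add)
qed

lemma deglex_irrefl: "\<not> deglex \<alpha> \<alpha>"
  by (auto simp: deglex_def)

lemma deglex_trans: "deglex \<alpha> \<beta> \<Longrightarrow> deglex \<beta> \<gamma> \<Longrightarrow> deglex \<alpha> \<gamma>"
proof -
  assume a: "deglex \<alpha> \<beta>" "deglex \<beta> \<gamma>"
  show "deglex \<alpha> \<gamma>"
  proof (cases "deg \<alpha> = deg \<beta> \<and> deg \<beta> = deg \<gamma>")
    case True
    then obtain k m where k: "\<alpha> k < \<beta> k" "\<forall>j<k. \<alpha> j = \<beta> j" and m: "\<beta> m < \<gamma> m" "\<forall>j<m. \<beta> j = \<gamma> j"
      using a by (auto simp: deglex_def)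
    have "\<alpha> (min k m) < \<gamma> (min k m)"
      using k m by (cases k m rule: linorder_cases) (auto simp: min_def)
    moreover have "\<forall>j<min k m. \<alpha> j = \<gamma> j" using k m by auto
    ultimately show ?thesis using True by (auto simp: deglex_def)
  next
    case False
    then show ?thesis using a by (auto simp: deglex_def)
  qed
qed

lemma deglex_max:
  assumes "finite S" "S \<noteq> {}"
  shows "\<exists>\<alpha>\<in>S. \<forall>\<gamma>\<in>S. deglex \<gamma> \<alpha> \<or> \<gamma> = \<alpha>"
  using assms
proof (induction rule: finite_ne_induct)
  case (insert \<beta> S)
  then obtain \<alpha> where \<alpha>: "\<alpha> \<in> S" "\<forall>\<gamma>\<in>S. deglex \<gamma> \<alpha> \<or> \<gamma> = \<alpha>" by auto
  show ?case
  proof (cases "deglex \<alpha> \<beta>")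
    case True
    then have "\<forall>\<gamma>\<in>insert \<beta> S. deglex \<gamma> \<beta> \<or> \<gamma> = \<beta>" using \<alpha> deglex_trans by blast
    then show ?thesis by blast
  next
    case False
    then have "\<forall>\<gamma>\<in>insert \<beta> S. deglex \<gamma> \<alpha> \<or> \<gamma> = \<alpha>" using \<alpha> deglex_total by blast
    then show ?thesis using \<alpha>(1) by blast
  qed
qed simp

lemma deglex_deg: "deglex \<alpha> \<beta> \<or> \<alpha> = \<beta> \<Longrightarrow> deg \<alpha> \<le> deg \<beta>"
  by (auto simp: deglex_def)

definition drop_term :: "(nat \<Rightarrow> nat) \<Rightarrow> 'a \<Rightarrow> 'a"
  where "drop_term \<alpha> a = a \<ominus> coef a \<alpha> \<otimes> mon \<alpha>"

lemma drop_term_closed: "a \<in> carrier A \<Longrightarrow> drop_term \<alpha> a \<in> carrier A"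
  by (simp add: drop_term_def)

lemma drop_term_eq: "a \<in> carrier A \<Longrightarrow> a = coef a \<alpha> \<otimes> mon \<alpha> \<oplus> drop_term \<alpha> a"
proof -
  assume a: "a \<in> carrier A"
  then have "coef a \<alpha> \<otimes> mon \<alpha> \<in> carrier A" by simp
  then show ?thesis using a unfolding drop_term_def by algebra
qed

lemma coef_drop_term:
  "a \<in> carrier A \<Longrightarrow> \<alpha> \<in> MI \<Longrightarrow> coef (drop_term \<alpha> a) \<gamma> = (if \<gamma> = \<alpha> then \<zero> else coef a \<gamma>)"
  by (auto simp: drop_term_def minus_eq coef_closed r_neg)

lemma summand_eq:
  assumes "p \<in> carrier A" "q \<in> carrier A"
  shows "q = (p \<oplus> q) \<oplus> \<ominus> p"
  using assms by algebra

lemma coef_mult_zero: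
  assumes u: "u \<in> carrier A" and f: "f \<in> carrier A"
    and z: "\<And>\<gamma> \<epsilon>. coef u \<gamma> \<noteq> \<zero> \<Longrightarrow> coef f \<epsilon> \<noteq> \<zero> \<Longrightarrow>
      coef ((coef u \<gamma> \<otimes> mon \<gamma>) \<otimes> (coef f \<epsilon> \<otimes> mon \<epsilon>)) \<zeta> = \<zero>"
  shows "coef (u \<otimes> f) \<zeta> = \<zero>"
proof (rule term_induct[where P = "\<lambda>u. coef (u \<otimes> f) \<zeta> = \<zero>", OF u])
  fix \<gamma> assume \<gamma>: "coef u \<gamma> \<noteq> \<zero>"
  show "coef ((coef u \<gamma> \<otimes> mon \<gamma>) \<otimes> f) \<zeta> = \<zero>"
    by (rule term_induct[where P = "\<lambda>f. coef ((coef u \<gamma> \<otimes> mon \<gamma>) \<otimes> f) \<zeta> = \<zero>", OF f])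
      (use u \<gamma> z in \<open>auto simp: r_distr\<close>)
qed (use f in \<open>auto simp: l_distr\<close>)

end

context compatible_ideal
begin

lemma coef_mult_term:
  assumes \<gamma>: "\<gamma> \<in> MI" and \<epsilon>: "\<epsilon> \<in> MI" and a: "a \<in> R" and b: "b \<in> R"
    and deg: "deg \<gamma> + deg \<epsilon> \<le> deg \<zeta>"
  shows "\<exists>b'\<in>R. (\<forall>a\<in>R. a \<otimes> b' \<in> N \<longleftrightarrow> a \<otimes> b \<in> N) \<and>
    coef ((a \<otimes> mon \<gamma>) \<otimes> (b \<otimes> mon \<epsilon>)) \<zeta> = (if \<zeta> = (\<lambda>k. \<gamma> k + \<epsilon> k) then a \<otimes> b' else \<zero>)"
proof -
  obtain b' p where b': "b' \<in> R" "\<forall>a\<in>R. a \<otimes> b' \<in> N \<longleftrightarrow> a \<otimes> b \<in> N"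
    and p: "p \<in> below (deg \<gamma> + deg \<epsilon>)"
    and eq: "mon \<gamma> \<otimes> (b \<otimes> mon \<epsilon>) = b' \<otimes> mon (\<lambda>k. \<gamma> k + \<epsilon> k) \<oplus> p"
    using mult_term_leading[OF \<gamma> \<epsilon> b] by blast
  have c: "a \<in> carrier A" "b \<in> carrier A" "b' \<in> carrier A" "p \<in> carrier A"
    using a b b' p by (auto simp: R_sub belowD)
  have "coef p \<zeta> = \<zero>" using p deg by (simp add: below_def)
  then have "coef (b' \<otimes> mon (\<lambda>k. \<gamma> k + \<epsilon> k) \<oplus> p) \<zeta> = (if \<zeta> = (\<lambda>k. \<gamma> k + \<epsilon> k) then b' else \<zero>)"
    using c b' \<gamma> \<epsilon> by simp
  moreover have "(a \<otimes> mon \<gamma>) \<otimes> (b \<otimes> mon \<epsilon>) = a \<otimes> (mon \<gamma> \<otimes> (b \<otimes> mon \<epsilon>))"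
    using c by (simp add: m_assoc)
  ultimately have "coef ((a \<otimes> mon \<gamma>) \<otimes> (b \<otimes> mon \<epsilon>)) \<zeta> = (if \<zeta> = (\<lambda>k. \<gamma> k + \<epsilon> k) then a \<otimes> b' else \<zero>)"
    unfolding eq using a c by simp
  then show ?thesis using b' by blast
qed

text \<open>
  Only the two leading terms contribute to the coefficient of \<open>x\<^bsup>\<alpha>+\<beta>\<^esup>\<close> in \<open>uf\<close>: any other
  pair of terms has a smaller leading monomial, and its corrections have degree less than
  \<open>deg \<alpha> + deg \<beta>\<close>.
\<close>

lemma leading_coefs_in_N:
  assumes u: "u \<in> carrier A" and f: "f \<in> carrier A" and uf: "u \<otimes> f \<in> coefs_in N"
    and \<alpha>: "\<alpha> \<in> MI" "\<And>\<gamma>. coef u \<gamma> \<noteq> \<zero> \<Longrightarrow> deglex \<gamma> \<alpha> \<or> \<gamma> = \<alpha>"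
    and \<beta>: "\<beta> \<in> MI" "\<And>\<epsilon>. coef f \<epsilon> \<noteq> \<zero> \<Longrightarrow> deglex \<epsilon> \<beta> \<or> \<epsilon> = \<beta>"
  shows "coef u \<alpha> \<otimes> coef f \<beta> \<in> N"
proof -
  define \<zeta> where "\<zeta> = (\<lambda>k. \<alpha> k + \<beta> k)"
  define a where "a = coef u \<alpha> \<otimes> mon \<alpha>"
  define b where "b = coef f \<beta> \<otimes> mon \<beta>"
  define u' where "u' = drop_term \<alpha> u"
  define f' where "f' = drop_term \<beta> f"
  have c: "a \<in> carrier A" "b \<in> carrier A" "u' \<in> carrier A" "f' \<in> carrier A"
    using u f by (auto simp: a_def b_def u'_def f'_def drop_term_closed)
  have R: "coef u \<gamma> \<in> R" "coef f \<gamma> \<in> R" for \<gamma> using u f by (auto simp: coef_closed)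
  have ca: "coef a \<gamma> = (if \<gamma> = \<alpha> then coef u \<alpha> else \<zero>)" for \<gamma>
    using R R_sub[OF R(1)] \<alpha> by (simp add: a_def)
  have cross: "coef ((coef u \<gamma> \<otimes> mon \<gamma>) \<otimes> (coef f \<epsilon> \<otimes> mon \<epsilon>)) \<zeta> = \<zero>"
    if nz: "coef u \<gamma> \<noteq> \<zero>" "coef f \<epsilon> \<noteq> \<zero>" and ne: "\<gamma> \<noteq> \<alpha> \<or> \<epsilon> \<noteq> \<beta>" for \<gamma> \<epsilon>
  proof -
    have o: "deglex \<gamma> \<alpha> \<or> \<gamma> = \<alpha>" "deglex \<epsilon> \<beta> \<or> \<epsilon> = \<beta>" using nz \<alpha> \<beta> by auto
    have "deglex (\<lambda>k. \<gamma> k + \<epsilon> k) \<zeta>"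
    proof (cases "\<gamma> = \<alpha>")
      case False
      then show ?thesis using o deglex_add[of \<gamma> \<alpha> \<epsilon> \<beta>] by (simp add: \<zeta>_def)
    next
      case True
      then show ?thesis using o ne deglex_add[of \<epsilon> \<beta> \<gamma> \<alpha>] by (simp add: \<zeta>_def add.commute)
    qed
    then have "\<zeta> \<noteq> (\<lambda>k. \<gamma> k + \<epsilon> k)" using deglex_irrefl by auto
    moreover have "deg \<gamma> + deg \<epsilon> \<le> deg \<zeta>"
      using deglex_deg[OF o(1)] deglex_deg[OF o(2)] by (simp add: \<zeta>_def deg_add)
    moreover have "\<gamma> \<in> MI" "\<epsilon> \<in> MI" using nz u f coef_support by auto
    ultimately show ?thesis using coef_mult_term[of \<gamma> \<epsilon> "coef u \<gamma>" "coef f \<epsilon>" \<zeta>] R by auto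
  qed
  have 1: "coef (u' \<otimes> f) \<zeta> = \<zero>"
    by (rule coef_mult_zero[OF c(3) f])
      (use cross u \<alpha> in \<open>auto simp: u'_def coef_drop_term split: if_splits\<close>)
  have 2: "coef (a \<otimes> f') \<zeta> = \<zero>"
    by (rule coef_mult_zero[OF c(1,4)])
      (use cross f \<beta> in \<open>auto simp: f'_def ca coef_drop_term split: if_splits\<close>)
  have "u \<otimes> f = (a \<oplus> u') \<otimes> f" using drop_term_eq[OF u, of \<alpha>] by (simp add: a_def u'_def)
  also have "\<dots> = a \<otimes> (b \<oplus> f') \<oplus> u' \<otimes> f"
    using drop_term_eq[OF f, of \<beta>] c f by (simp add: b_def f'_def l_distr)
  also have "\<dots> = a \<otimes> b \<oplus> a \<otimes> f' \<oplus> u' \<otimes> f" using c by (simp add: r_distr)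
  finally have "coef (u \<otimes> f) \<zeta> = coef (a \<otimes> b) \<zeta>" using 1 2 c f by simp
  then have "coef (a \<otimes> b) \<zeta> \<in> N" using uf by (metis (mono_tags, lifting) coefs_in_def mem_Collect_eq)
  then show ?thesis
    using coef_mult_term[OF \<alpha>(1) \<beta>(1) R(1)[of \<alpha>] R(2)[of \<beta>], of \<zeta>] R
    by (auto simp: a_def b_def \<zeta>_def deg_add)
qed

text \<open>
  By induction on the total number of terms. Let \<open>a\<close> and \<open>b\<close> be the leading coefficients, so that
  \<open>ab \<in> N\<close> and \<open>ba \<in> N\<close>. Multiplying \<open>u\<close> by \<open>b\<close> from the left makes its leading term vanish modulo \<open>N\<close>,
  so the induction hypothesis applies to the remaining terms and yields \<open>b u\<^sub>\<gamma> b \<in> N\<close>, hence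
  \<open>u\<^sub>\<gamma> b \<in> N\<close> as the quotient is reduced. Then \<open>u\<close> times the leading term of \<open>f\<close> has
  coefficients in \<open>N\<close>, and this term can be dropped from \<open>f\<close>.
\<close>

lemma coefs_mult_in_N:
  assumes "u \<in> carrier A" "f \<in> carrier A" "u \<otimes> f \<in> coefs_in N"
  shows "coef u \<gamma> \<otimes> coef f \<epsilon> \<in> N"
  using assms
proof (induction "card {\<alpha>. coef u \<alpha> \<noteq> \<zero>} + card {\<alpha>. coef f \<alpha> \<noteq> \<zero>}"
    arbitrary: u f \<gamma> \<epsilon> rule: less_induct)
  case less
  note u = less.prems(1) and f = less.prems(2) and uf = less.prems(3)
  have R: "coef u \<gamma> \<in> R" "coef f \<gamma> \<in> R" for \<gamma> using u f by (auto simp: coef_closed)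
  note fin = coef_finite[OF u] coef_finite[OF f]
  show ?case
  proof (cases "{\<alpha>. coef u \<alpha> \<noteq> \<zero>} = {} \<or> {\<alpha>. coef f \<alpha> \<noteq> \<zero>} = {}")
    case True
    then have "coef u \<gamma> = \<zero> \<or> coef f \<epsilon> = \<zero>" by auto
    then show ?thesis using N_zero u f by auto
  next
    case False
    obtain \<alpha> where \<alpha>: "coef u \<alpha> \<noteq> \<zero>" "\<And>\<gamma>. coef u \<gamma> \<noteq> \<zero> \<Longrightarrow> deglex \<gamma> \<alpha> \<or> \<gamma> = \<alpha>"
      using deglex_max[OF fin(1)] False by auto
    obtain \<beta> where \<beta>: "coef f \<beta> \<noteq> \<zero>" "\<And>\<epsilon>. coef f \<epsilon> \<noteq> \<zero> \<Longrightarrow> deglex \<epsilon> \<beta> \<or> \<epsilon> = \<beta>"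
      using deglex_max[OF fin(2)] False by auto
    have MI: "\<alpha> \<in> MI" "\<beta> \<in> MI" using \<alpha>(1) \<beta>(1) u f coef_support by auto
    have ab: "coef u \<alpha> \<otimes> coef f \<beta> \<in> N"
      using leading_coefs_in_N[OF u f uf MI(1) \<alpha>(2) MI(2) \<beta>(2)] .
    define b where "b = coef f \<beta>"
    have b: "b \<in> R" "b \<in> carrier A" using R by (auto simp: b_def R_sub)
    have ba: "b \<otimes> coef u \<alpha> \<in> N" using N_swap[OF R(1) b(1)] ab by (simp add: b_def)
    have ub: "coef u \<gamma> \<otimes> b \<in> N" for \<gamma>
    proof (cases "\<gamma> = \<alpha>")
      case True
      then show ?thesis using ab by (simp add: b_def)
    next
      case False
      define v where "v = b \<otimes> drop_term \<alpha> u"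
      have v: "v \<in> carrier A" using b u by (simp add: v_def drop_term_closed)
      have cv: "coef v \<gamma> = (if \<gamma> = \<alpha> then \<zero> else b \<otimes> coef u \<gamma>)" for \<gamma>
        using b u MI by (simp add: v_def drop_term_closed coef_drop_term)
      have "{\<gamma>. coef v \<gamma> \<noteq> \<zero>} \<subset> {\<gamma>. coef u \<gamma> \<noteq> \<zero>}"
        using \<alpha>(1) b by (auto simp: cv)
      then have card: "card {\<gamma>. coef v \<gamma> \<noteq> \<zero>} < card {\<gamma>. coef u \<gamma> \<noteq> \<zero>}"
        using fin(1) by (rule psubset_card_mono[rotated])
      define w where "w = (b \<otimes> coef u \<alpha>) \<otimes> (mon \<alpha> \<otimes> f)"
      have w: "w \<in> coefs_in N"
        unfolding w_def using f by (intro coefs_in_scalar stable_N ba) auto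
      have "b \<otimes> (u \<otimes> f) = b \<otimes> ((coef u \<alpha> \<otimes> mon \<alpha> \<oplus> drop_term \<alpha> u) \<otimes> f)"
        using drop_term_eq[OF u, of \<alpha>] by simp
      also have "\<dots> = w \<oplus> v \<otimes> f"
        using b u f by (simp add: w_def v_def drop_term_closed l_distr r_distr m_assoc)
      finally have "v \<otimes> f = b \<otimes> (u \<otimes> f) \<oplus> \<ominus> w"
        using summand_eq[of w "v \<otimes> f"] coefs_in_carrier[OF w] v f by simp
      then have vf: "v \<otimes> f \<in> coefs_in N"
        using coefs_in_add[OF stable_N coefs_in_N_left[OF b(1) uf] coefs_in_N_minus[OF w]] by simp
      have "coef v \<gamma> \<otimes> coef f \<beta> \<in> N"
        using less.hyps[OF _ v f vf] card by simp
      then have "b \<otimes> coef u \<gamma> \<otimes> b \<in> N" using False by (simp add: cv b_def)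
      then have "(b \<otimes> coef u \<gamma> \<otimes> b) \<otimes> coef u \<gamma> \<in> N" using N_right R by blast
      then have "(b \<otimes> coef u \<gamma>) \<otimes> (b \<otimes> coef u \<gamma>) \<in> N" using b u by (simp add: m_assoc)
      then have "b \<otimes> coef u \<gamma> \<in> N" using N_square R_mult[OF b(1) R(1)] by blast
      then show ?thesis using N_swap[OF b(1) R(1)] by blast
    qed
    define g where "g = drop_term \<beta> f"
    have g: "g \<in> carrier A" using f by (simp add: g_def drop_term_closed)
    have cg: "coef g \<epsilon> = (if \<epsilon> = \<beta> then \<zero> else coef f \<epsilon>)" for \<epsilon>
      using f MI by (simp add: g_def coef_drop_term)
    have "{\<gamma>. coef g \<gamma> \<noteq> \<zero>} \<subset> {\<gamma>. coef f \<gamma> \<noteq> \<zero>}" using \<beta>(1) by (auto simp: cg)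
    then have card: "card {\<gamma>. coef g \<gamma> \<noteq> \<zero>} < card {\<gamma>. coef f \<gamma> \<noteq> \<zero>}"
      using fin(2) by (rule psubset_card_mono[rotated])
    define w where "w = u \<otimes> (b \<otimes> mon \<beta>)"
    have w: "w \<in> coefs_in N"
      unfolding w_def using u b MI ub N_zero by (intro mult_coefs_in_N) auto
    have "u \<otimes> f = u \<otimes> (b \<otimes> mon \<beta> \<oplus> g)"
      using drop_term_eq[OF f, of \<beta>] by (simp add: b_def g_def)
    also have "\<dots> = w \<oplus> u \<otimes> g" using u b g by (simp add: w_def r_distr)
    finally have "u \<otimes> g = u \<otimes> f \<oplus> \<ominus> w"
      using summand_eq[of w "u \<otimes> g"] coefs_in_carrier[OF w] u g by simp
    then have ug: "u \<otimes> g \<in> coefs_in N"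
      using coefs_in_add[OF stable_N uf coefs_in_N_minus[OF w]] by simp
    show ?thesis
    proof (cases "\<epsilon> = \<beta>")
      case True
      then show ?thesis using ub by (simp add: b_def)
    next
      case False
      then show ?thesis using less.hyps[OF _ u g ug, of \<gamma> \<epsilon>] card by (simp add: cg)
    qed
  qed
qed

text \<open>
  If \<open>b\<^sup>2\<close> has coefficients in \<open>N\<close>, then the squares of the coefficients of \<open>b\<close> lie in \<open>N\<close>, hence so
  do the coefficients themselves.
  Halving the exponent repeatedly descends from a vanishing power of \<open>a\<close> to \<open>a\<close>, so exponents that are
  powers of two are used.
\<close>

lemma nilpotent_coefs:
  assumes a: "a \<in> nilpotents A"
  shows "a \<in> coefs_in N"
proof -
  have c: "a \<in> carrier A" using a by (simp add: nilpotents_def)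
  have square: "b \<in> coefs_in N" if b: "b \<in> carrier A" "b \<otimes> b \<in> coefs_in N" for b
    using coefs_mult_in_N[OF b(1) b] N_square coef_closed[OF b(1)] b by (auto simp: coefs_in_def)
  have descent: "a [^] ((2::nat) ^ m) \<in> coefs_in N \<Longrightarrow> a \<in> coefs_in N" for m
  proof (induction m)
    case (Suc m)
    have "a [^] ((2::nat) ^ Suc m) = a [^] ((2::nat) ^ m) \<otimes> a [^] ((2::nat) ^ m)"
      using c by (simp add: nat_pow_mult mult_2)
    then show ?case using Suc square[of "a [^] ((2::nat) ^ m)"] c by simp
  qed (use c in simp)
  obtain k :: nat where k: "a [^] k = \<zero>" using a by (auto simp: nilpotents_def)
  have "a [^] ((2::nat) ^ k) = a [^] k \<otimes> a [^] (2 ^ k - k)"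
    using c less_exp[of k] by (simp add: nat_pow_mult)
  then have "a [^] ((2::nat) ^ k) = \<zero>" using k c by simp
  then show ?thesis using descent[of k] coefs_in_zero[OF stable_N] by simp
qed

text \<open>
  Since the elements with coefficients in \<open>N\<close> form the two-sided ideal \<open>cA\<close>, the product
  \<open>(c\<^sup>k a)f\<close> with \<open>f \<in> cA\<close> lies in \<open>c\<^sup>k cA\<close>; thus \<open>f\<^sup>k \<in> c\<^sup>k A\<close>, although \<open>c\<close> need not be central.
\<close>

lemma nilpotents_eq_coefs:
  assumes c: "c \<in> nilpotents A" and N: "N = {c \<otimes> r | r. r \<in> R}" and cR: "c \<in> R"
  shows "nilpotents A = coefs_in N"
proof
  show "nilpotents A \<subseteq> coefs_in N" using nilpotent_coefs by blast
  show "coefs_in N \<subseteq> nilpotents A"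
  proof
    fix f assume f: "f \<in> coefs_in N"
    have fc: "f \<in> carrier A" and cc: "c \<in> carrier A" using f c by (auto simp: coefs_in_carrier nilpotents_def)
    have cA: "coefs_in N = {c \<otimes> a | a. a \<in> carrier A}" unfolding N using principal_coefs[OF cR] .
    have left: "a \<otimes> f \<in> coefs_in N" if a: "a \<in> carrier A" for a
    proof (rule mult_coefs_in_N[OF a fc])
      show "coef a \<alpha> \<otimes> coef f \<beta> \<in> N" for \<alpha> \<beta>
        using f a by (intro N_left) (auto simp: coefs_in_def coef_closed)
    qed
    have pow: "\<exists>a\<in>carrier A. f [^] k = c [^] k \<otimes> a" for k :: nat
    proof (induction k)
      case 0
      show ?case using fc by (intro bexI[of _ \<one>]) auto
    next
      case (Suc k)
      then obtain a where a: "a \<in> carrier A" "f [^] k = c [^] k \<otimes> a" by auto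
      obtain b where b: "b \<in> carrier A" "a \<otimes> f = c \<otimes> b" using left[OF a(1)] cA by auto
      have "f [^] Suc k = c [^] k \<otimes> (a \<otimes> f)" using a fc cc by (simp add: m_assoc)
      also have "\<dots> = c [^] Suc k \<otimes> b" unfolding b(2) using b(1) cc by (simp add: m_assoc)
      finally show ?case using b(1) by blast
    qed
    obtain k :: nat where "c [^] k = \<zero>" using c by (auto simp: nilpotents_def)
    then have "f [^] k = \<zero>" using pow[of k] by auto
    then show "f \<in> nilpotents A" using fc by (auto simp: nilpotents_def)
  qed
qed

lemma weak_annihilator_coefs:
  assumes nil: "nilpotents A = coefs_in N" and U: "U \<subseteq> carrier A"
  shows "weak_annihilator A U =
    coefs_in {b \<in> R. \<forall>a\<in>{coef u \<alpha> | u \<alpha>. u \<in> U}. a \<otimes> b \<in> N}"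
proof -
  have prod: "u \<otimes> f \<in> coefs_in N \<longleftrightarrow> (\<forall>\<alpha> \<beta>. coef u \<alpha> \<otimes> coef f \<beta> \<in> N)"
    if "u \<in> U" "f \<in> carrier A" for u f
    using that U coefs_mult_in_N[of u f] mult_coefs_in_N[of u f] by blast
  have "f \<in> weak_annihilator A U \<longleftrightarrow>
      f \<in> carrier A \<and> (\<forall>u\<in>U. \<forall>\<alpha> \<beta>. coef u \<alpha> \<otimes> coef f \<beta> \<in> N)" for f
    unfolding weak_annihilator_def nil using prod by blast
  moreover have "f \<in> coefs_in {b \<in> R. \<forall>a\<in>{coef u \<alpha> | u \<alpha>. u \<in> U}. a \<otimes> b \<in> N} \<longleftrightarrow>
      f \<in> carrier A \<and> (\<forall>u\<in>U. \<forall>\<alpha> \<beta>. coef u \<alpha> \<otimes> coef f \<beta> \<in> N)" for f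
    unfolding coefs_in_def using coef_closed by blast
  ultimately show ?thesis by blast
qed

end

section \<open>Nilpotent elements of the coefficient ring\<close>

lemma (in ring) nilpotents_swap:
  assumes a: "a \<in> carrier R" and b: "b \<in> carrier R" and ab: "a \<otimes> b \<in> nilpotents R"
  shows "b \<otimes> a \<in> nilpotents R"
proof -
  have pow: "(b \<otimes> a) [^] Suc k = b \<otimes> (a \<otimes> b) [^] k \<otimes> a" for k
    using a b by (induction k) (simp_all add: m_assoc)
  obtain k :: nat where "(a \<otimes> b) [^] k = \<zero>" using ab by (auto simp: nilpotents_def)
  then have "(b \<otimes> a) [^] Suc k = \<zero>" using a b pow[of k] by simp
  then show ?thesis using a b unfolding nilpotents_def by blast
qed

lemma (in ring) nilpotents_square:
  assumes a: "a \<in> carrier R" and aa: "a \<otimes> a \<in> nilpotents R"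
  shows "a \<in> nilpotents R"
proof -
  obtain k :: nat where "(a \<otimes> a) [^] k = \<zero>" using aa by (auto simp: nilpotents_def)
  moreover have "a \<otimes> a = a [^] (2::nat)" using a by (simp add: numeral_2_eq_2)
  ultimately have "a [^] (2 * k) = \<zero>" using a by (simp add: nat_pow_pow)
  then show ?thesis using a unfolding nilpotents_def by blast
qed

text \<open>
  In \<open>u\<^sup>k = 0\<close> the factors are replaced by \<open>v\<close> one after the other, from left to right.
\<close>

lemma (in ring) nilpotents_transfer:
  assumes u: "u \<in> nilpotents R" and v: "v \<in> carrier R"
    and step: "\<And>p q. p \<in> carrier R \<Longrightarrow> q \<in> carrier R \<Longrightarrow> p \<otimes> u \<otimes> q = \<zero> \<Longrightarrow> p \<otimes> v \<otimes> q = \<zero>"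
  shows "v \<in> nilpotents R"
proof -
  have uc: "u \<in> carrier R" using u by (simp add: nilpotents_def)
  have *: "p \<otimes> u [^] k = \<zero> \<Longrightarrow> p \<otimes> v [^] k = \<zero>" if "p \<in> carrier R" for k :: nat and p
    using that
  proof (induction k arbitrary: p)
    case (Suc k)
    have "p \<otimes> u \<otimes> u [^] k = \<zero>"
      using Suc.prems uc nat_pow_Suc2[OF uc, of k] by (simp add: m_assoc del: nat_pow_Suc)
    then have "p \<otimes> v \<otimes> u [^] k = \<zero>" using step Suc.prems uc by simp
    then have "p \<otimes> v \<otimes> v [^] k = \<zero>" using Suc.IH[of "p \<otimes> v"] Suc.prems v by simp
    then show ?case
      using Suc.prems v nat_pow_Suc2[OF v, of k] by (simp add: m_assoc del: nat_pow_Suc)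
  qed simp
  obtain k :: nat where "u [^] k = \<zero>" using u by (auto simp: nilpotents_def)
  then have "v [^] k = \<zero>" using *[of \<one> k] uc v by simp
  then show ?thesis using v unfolding nilpotents_def by blast
qed

lemma map_power_single:
  assumes "i < n"
  shows "map_power n \<phi> (bump i (\<lambda>_. 0)) = \<phi> i"
proof -
  have zero: "i \<notin> set js \<Longrightarrow> foldr (\<lambda>j g. (\<phi> j ^^ bump i (\<lambda>_. 0) j) \<circ> g) js id = id" for js
    by (induction js) (auto simp: bump_def)
  have "i \<in> set js \<Longrightarrow> distinct js \<Longrightarrow>
      foldr (\<lambda>j g. (\<phi> j ^^ bump i (\<lambda>_. 0) j) \<circ> g) js id = \<phi> i" for js
  proof (induction js)
    case (Cons j js)
    have split: "foldr (\<lambda>j g. (\<phi> j ^^ bump i (\<lambda>_. 0) j) \<circ> g) (j # js) id =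
        (\<phi> j ^^ bump i (\<lambda>_. 0) j) \<circ> foldr (\<lambda>j g. (\<phi> j ^^ bump i (\<lambda>_. 0) j) \<circ> g) js id"
      by (simp only: foldr.simps o_apply)
    show ?case
    proof (cases "j = i")
      case True
      then have "i \<notin> set js" using Cons.prems by auto
      note zero = zero[OF this]
      show ?thesis unfolding split zero using True by (simp add: bump_def)
    next
      case False
      then have "i \<in> set js" "distinct js" using Cons.prems by auto
      note IH = Cons.IH[OF this]
      show ?thesis unfolding split IH using False by (simp add: bump_def)
    qed
  qed simp
  then show ?thesis using assms unfolding map_power_def by simp
qed

lemma bump_zero_multi_index: "i < n \<Longrightarrow> bump i (\<lambda>_. 0) \<in> multi_indices n"
  by (auto simp: multi_indices_def bump_def)

text \<open>
  Compatibility concerns products that are zero; it is carried over to products that are nilpotent by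
  replacing \<open>b\<close> by \<open>\<sigma>\<^sub>i(b)\<close> or \<open>\<delta>\<^sub>i(b)\<close> inside a longer vanishing product \<open>p ab q\<close>. For \<open>\<sigma>\<^sub>i\<close>,
  compatibility is applied to \<open>pa \<cdot> bq\<close> and then to \<open>pa \<sigma>\<^sub>i(b) \<cdot> q\<close>. For \<open>\<delta>\<^sub>i\<close>, the
  expansion of \<open>\<delta>\<^sub>i(bq)\<close> leaves the extra summand \<open>pa \<sigma>\<^sub>i(b) \<delta>\<^sub>i(q)\<close>, which vanishes by
  the first case since \<open>pab \<delta>\<^sub>i(q) = 0\<close>.
\<close>

lemma (in skew_PBW_maps) compatible_ideal_nilpotents:
  assumes Sigma: "Sigma_compatible (A\<lparr>carrier := R\<rparr>) n \<sigma>"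
    and Delta: "Delta_compatible (A\<lparr>carrier := R\<rparr>) n \<delta>"
    and N: "N = nilpotents (A\<lparr>carrier := R\<rparr>)" and principal: "N = {c \<otimes> r | r. r \<in> R}"
    and c: "c \<in> R"
  shows "compatible_ideal A R n x \<sigma> \<delta> N"
proof -
  interpret S: ring "A\<lparr>carrier := R\<rparr>" using subring_is_ring[OF coeff_subring] .
  have sig: "a \<otimes> \<sigma> i b = \<zero> \<longleftrightarrow> a \<otimes> b = \<zero>" if "i < n" "a \<in> R" "b \<in> R" for i a b
  proof -
    have "a \<otimes> map_power n \<sigma> (bump i (\<lambda>_. 0)) b = \<zero> \<longleftrightarrow> a \<otimes> b = \<zero>"
      using Sigma that bump_zero_multi_index[OF that(1)] by (simp add: Sigma_compatible_def)
    then show ?thesis by (simp only: map_power_single[OF that(1)])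
  qed
  have del: "a \<otimes> \<delta> i b = \<zero>" if "i < n" "a \<in> R" "b \<in> R" "a \<otimes> b = \<zero>" for i a b
  proof -
    have "a \<otimes> map_power n \<delta> (bump i (\<lambda>_. 0)) b = \<zero>"
      using Delta that bump_zero_multi_index[OF that(1)] by (simp add: Delta_compatible_def)
    then show ?thesis by (simp only: map_power_single[OF that(1)])
  qed
  \<comment> \<open>Replacing \<open>bq\<close> by its image also puts \<open>\<sigma> i\<close> on \<open>q\<close>; a second use of compatibility removes it.\<close>
  have sig3: "p \<otimes> (a \<otimes> \<sigma> i b) \<otimes> q = \<zero> \<longleftrightarrow> p \<otimes> (a \<otimes> b) \<otimes> q = \<zero>"
    if i: "i < n" and R: "a \<in> R" "b \<in> R" "p \<in> R" "q \<in> R" for i a b p q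
  proof -
    note cl = R[THEN R_sub] R_sub[OF sigma_closed[OF i R(2)]] R_sub[OF sigma_closed[OF i R(4)]]
    have "p \<otimes> (a \<otimes> b) \<otimes> q = \<zero> \<longleftrightarrow> (p \<otimes> a) \<otimes> (b \<otimes> q) = \<zero>" using cl by (simp add: m_assoc)
    also have "\<dots> \<longleftrightarrow> (p \<otimes> a) \<otimes> \<sigma> i (b \<otimes> q) = \<zero>"
      using sig[OF i R_mult[OF R(3,1)] R_mult[OF R(2,4)]] by simp
    also have "\<dots> \<longleftrightarrow> (p \<otimes> a \<otimes> \<sigma> i b) \<otimes> \<sigma> i q = \<zero>"
      using sigma_mult[OF i R(2,4)] cl by (simp add: m_assoc)
    also have "\<dots> \<longleftrightarrow> (p \<otimes> a \<otimes> \<sigma> i b) \<otimes> q = \<zero>"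
      using sig[OF i R_mult[OF R_mult[OF R(3,1)] sigma_closed[OF i R(2)]] R(4)] by simp
    finally show ?thesis using cl by (simp add: m_assoc)
  qed
  have del3: "p \<otimes> (a \<otimes> \<delta> i b) \<otimes> q = \<zero>"
    if i: "i < n" and R: "a \<in> R" "b \<in> R" "p \<in> R" "q \<in> R" and z: "p \<otimes> (a \<otimes> b) \<otimes> q = \<zero>" for i a b p q
  proof -
    note sd = sigma_closed[OF i R(2)] delta_closed[OF i R(2)] delta_closed[OF i R(4)]
    note cl = R[THEN R_sub] sd[THEN R_sub]
    have pa: "p \<otimes> a \<in> R" using R R_mult by blast
    have 1: "(p \<otimes> a) \<otimes> \<delta> i (b \<otimes> q) = \<zero>"
      using del[OF i pa R_mult[OF R(2,4)]] z cl by (simp add: m_assoc)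
    have "(p \<otimes> a \<otimes> b) \<otimes> \<delta> i q = \<zero>"
      using del[OF i R_mult[OF pa R(2)] R(4)] z cl by (simp add: m_assoc)
    then have 2: "p \<otimes> (a \<otimes> \<sigma> i b) \<otimes> \<delta> i q = \<zero>"
      using sig3[OF i R(1,2,3) sd(3)] cl by (simp add: m_assoc)
    have "(p \<otimes> a) \<otimes> \<delta> i (b \<otimes> q) = p \<otimes> (a \<otimes> \<sigma> i b) \<otimes> \<delta> i q \<oplus> p \<otimes> (a \<otimes> \<delta> i b) \<otimes> q"
      unfolding delta_mult[OF i R(2,4)] using cl by (simp add: r_distr m_assoc)
    then show ?thesis using 1 2 cl by simp
  qed
  show ?thesis
  proof unfold_locales
    show "N \<subseteq> R" by (auto simp: N nilpotents_def)
    show "\<zero> \<in> N" unfolding principal using R_zero c by (auto simp: R_sub intro!: exI[of _ \<zero>])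
    show "a \<oplus> b \<in> N" if ab: "a \<in> N" "b \<in> N" for a b
    proof -
      obtain r s where rs: "r \<in> R" "s \<in> R" "a = c \<otimes> r" "b = c \<otimes> s" using ab principal by auto
      then have "a \<oplus> b = c \<otimes> (r \<oplus> s)" using c by (simp add: r_distr R_sub)
      then show ?thesis unfolding principal using rs R_add by blast
    qed
    show right: "a \<otimes> r \<in> N" if a: "a \<in> N" and r: "r \<in> R" for a r
    proof -
      obtain s where s: "s \<in> R" "a = c \<otimes> s" using a principal by auto
      then have "a \<otimes> r = c \<otimes> (s \<otimes> r)" using c r by (simp add: m_assoc R_sub)
      then show ?thesis unfolding principal using s r R_mult by blast
    qed
    show "r \<otimes> a \<in> N" if a: "a \<in> N" and r: "r \<in> R" for a r
      using S.nilpotents_swap[of a r] right[OF a r] a r by (auto simp: N nilpotents_def)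
    show "a \<in> N" if "a \<in> R" "a \<otimes> a \<in> N" for a
      using S.nilpotents_square[of a] that by (simp add: N)
    show "a \<otimes> \<sigma> i b \<in> N \<longleftrightarrow> a \<otimes> b \<in> N" if i: "i < n" and R: "a \<in> R" "b \<in> R" for i a b
    proof
      assume "a \<otimes> \<sigma> i b \<in> N"
      then show "a \<otimes> b \<in> N"
        using S.nilpotents_transfer[of "a \<otimes> \<sigma> i b" "a \<otimes> b"] sig3[OF i R] R by (simp add: N R_mult)
    next
      assume "a \<otimes> b \<in> N"
      then show "a \<otimes> \<sigma> i b \<in> N"
        using S.nilpotents_transfer[of "a \<otimes> b" "a \<otimes> \<sigma> i b"] sig3[OF i R] R sigma_closed[OF i R(2)]
        by (simp add: N R_mult)
    qed
    show "a \<otimes> \<delta> i b \<in> N" if i: "i < n" and R: "a \<in> R" "b \<in> R" and ab: "a \<otimes> b \<in> N" for i a b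
      using S.nilpotents_transfer[of "a \<otimes> b" "a \<otimes> \<delta> i b"] del3[OF i R] R delta_closed[OF i R(2)] ab
      by (simp add: N R_mult)
  qed
qed

section \<open>Weak annihilators in the extension\<close>

theorem theorem3p5:
  fixes A :: "('a, 'm) ring_scheme" and R :: "'a set" and n :: nat and x :: "nat \<Rightarrow> 'a"
    and \<sigma> \<delta> :: "nat \<Rightarrow> 'a \<Rightarrow> 'a"
  assumes "skew_PBW_extension A R n x"
    and "structure_maps A R n x \<sigma> \<delta>"
    and "Sigma_compatible (A\<lparr>carrier := R\<rparr>) n \<sigma>"
    and "Delta_compatible (A\<lparr>carrier := R\<rparr>) n \<delta>"
    and "NI_ring (A\<lparr>carrier := R\<rparr>)"
    and "\<And>Y. Y \<subseteq> R \<Longrightarrow> \<not> Y \<subseteq> nilpotents (A\<lparr>carrier := R\<rparr>) \<Longrightarrow>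
      generated_by_nilpotent (A\<lparr>carrier := R\<rparr>) (weak_annihilator (A\<lparr>carrier := R\<rparr>) Y)"
  shows "\<forall>U. U \<subseteq> carrier A \<longrightarrow> \<not> U \<subseteq> nilpotents A \<longrightarrow>
      generated_by_nilpotent A (weak_annihilator A U)"
proof (intro allI impI)
  fix U assume U: "U \<subseteq> carrier A" "\<not> U \<subseteq> nilpotents A"
  interpret skew_PBW_maps A R n x \<sigma> \<delta>
    by (intro skew_PBW_maps.intro skew_PBW_maps_axioms.intro assms)
  interpret S: ring "A\<lparr>carrier := R\<rparr>" using subring_is_ring[OF coeff_subring] .
  define N where "N = nilpotents (A\<lparr>carrier := R\<rparr>)"
  have N_iff: "a \<in> N \<longleftrightarrow> a \<in> R \<and> a \<in> nilpotents A" for a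
    by (auto simp: N_def nilpotents_def R_sub nat_pow_consistent[symmetric])
  have gen: "\<exists>c. c \<in> R \<and> c \<in> nilpotents A \<and> {b \<in> R. \<forall>a\<in>Y. a \<otimes>\<^bsub>A\<^esub> b \<in> N} = {c \<otimes>\<^bsub>A\<^esub> r | r. r \<in> R}"
    if "Y \<subseteq> R" "\<not> Y \<subseteq> N" for Y
    using assms(6)[of Y] that N_iff
    by (auto simp: generated_by_nilpotent_def weak_annihilator_def N_def[symmetric])
  \<comment> \<open>In the zero ring every element is nilpotent, which the choice of \<open>U\<close> excludes.\<close>
  have "\<one>\<^bsub>A\<^esub> \<notin> N"
  proof
    assume "\<one>\<^bsub>A\<^esub> \<in> N"
    then obtain k :: nat where "\<one>\<^bsub>A\<^esub> [^]\<^bsub>A\<^esub> k = \<zero>\<^bsub>A\<^esub>" by (auto simp: N_iff nilpotents_def)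
    then have "\<one>\<^bsub>A\<^esub> = \<zero>\<^bsub>A\<^esub>" by simp
    then have "a [^]\<^bsub>A\<^esub> (1::nat) = \<zero>\<^bsub>A\<^esub>" if "a \<in> carrier A" for a
      using that one_zeroD by auto
    then show False using U unfolding nilpotents_def by blast
  qed
  then obtain c where c: "c \<in> R" "c \<in> nilpotents A"
    and cN: "{b \<in> R. \<forall>a\<in>{\<one>\<^bsub>A\<^esub>}. a \<otimes>\<^bsub>A\<^esub> b \<in> N} = {c \<otimes>\<^bsub>A\<^esub> r | r. r \<in> R}"
    using gen[of "{\<one>\<^bsub>A\<^esub>}"] R_one by auto
  have "{b \<in> R. \<forall>a\<in>{\<one>\<^bsub>A\<^esub>}. a \<otimes>\<^bsub>A\<^esub> b \<in> N} = N" by (auto simp: N_iff R_sub)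
  then have principal: "N = {c \<otimes>\<^bsub>A\<^esub> r | r. r \<in> R}" using cN by simp
  interpret compatible_ideal A R n x \<sigma> \<delta> N
    using compatible_ideal_nilpotents[OF assms(3,4) N_def principal c(1)] .
  have nil: "nilpotents A = coefs_in N" using nilpotents_eq_coefs[OF c(2) principal c(1)] .
  define Y where "Y = {coef u \<alpha> | u \<alpha>. u \<in> U}"
  have "Y \<subseteq> R" using U by (auto simp: Y_def coef_closed)
  moreover have "\<not> Y \<subseteq> N" using U by (auto simp: Y_def nil coefs_in_def)
  ultimately obtain d where d: "d \<in> R" "d \<in> nilpotents A"
    "{b \<in> R. \<forall>a\<in>Y. a \<otimes>\<^bsub>A\<^esub> b \<in> N} = {d \<otimes>\<^bsub>A\<^esub> r | r. r \<in> R}"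
    using gen by blast
  have "weak_annihilator A U = {d \<otimes>\<^bsub>A\<^esub> a | a. a \<in> carrier A}"
    using weak_annihilator_coefs[OF nil U(1)] principal_coefs[OF d(1)] d(3) by (simp add: Y_def)
  then show "generated_by_nilpotent A (weak_annihilator A U)"
    using d(2) unfolding generated_by_nilpotent_def by blast
qed

end
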